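(* Let $n\ge 3$ be an integer. Then there exists an $n$-dimensional compact connected $C^0$-manifold $Y\subset\mathbb R^n$ with nonempty boundary $\partial Y$ such that the function $$\rho_Y(x,y)=\liminf_{x'\to x,\ y'\to y;\ x',y'\in \operatorname{Int} Y}\ \inf\{\, l(\gamma) : \gamma:[0,1]\to \operatorname{Int} Y \text{ a smooth path with } \gamma(0)=x',\ \gamma(1)=y'\,\}\qquad (x,y\in Y)$$ satisfies $\rho_Y(x,y)<\infty$ for all $x,y\in Y$, but $\rho_Y$ is not a metric on $Y$.
   Context: $\mathbb R^n$ carries the Euclidean metric, and $l(\gamma)$ is the Euclidean length of $\gamma$. An $n$-dimensional $C^0$-manifold $Y\subset\mathbb R^n$ with boundary is a subset which, with the topology induced from $\mathbb R^n$, is a topological $n$-manifold with boundary; $\partial Y$ denotes its boundary and $\operatorname{Int} Y=Y\setminus\partial Y$ its interior. The points $x',y'$ in the lower limit range over $\operatorname{Int} Y$, and convergence $x'\to x$, $y'\to y$ is in the topology of $\mathbb R^n$. *)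

theory Defs
  imports "HOL-Analysis.Analysis"
begin

section \<open>Topological manifolds with boundary in Euclidean space\<close>

text \<open>
  A chart maps a relatively open subset \<open>U\<close> of \<open>Y\<close> homeomorphically onto a relatively open
  subset \<open>V\<close> of a closed coordinate half-space. Any coordinate \<open>k\<close> may be used, since the
  half-spaces for different coordinates are isometric. Interior charts are the special case
  where \<open>V\<close> misses the bounding hyperplane. Being Hausdorff and second countable is automatic
  for subsets of a Euclidean space.
\<close>

definition half_space_chart ::
  "(real ^ 'n) set \<Rightarrow> 'n \<Rightarrow> (real ^ 'n) set \<Rightarrow> (real ^ 'n \<Rightarrow> real ^ 'n) \<Rightarrow> bool" where
  "half_space_chart Y k U \<phi> \<longleftrightarrow>
     openin (top_of_set Y) U \<and>
     (\<exists>V \<psi>. openin (top_of_set {z. 0 \<le> z $ k}) V \<and> homeomorphism U V \<phi> \<psi>)"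

definition C0_manifold_with_boundary :: "(real ^ 'n) set \<Rightarrow> bool" where
  "C0_manifold_with_boundary Y \<longleftrightarrow>
     (\<forall>p\<in>Y. \<exists>k U \<phi>. half_space_chart Y k U \<phi> \<and> p \<in> U)"

definition manifold_boundary :: "(real ^ 'n) set \<Rightarrow> (real ^ 'n) set" where
  "manifold_boundary Y =
     {p \<in> Y. \<exists>k U \<phi>. half_space_chart Y k U \<phi> \<and> p \<in> U \<and> \<phi> p $ k = 0}"

definition manifold_interior :: "(real ^ 'n) set \<Rightarrow> (real ^ 'n) set" where
  "manifold_interior Y = Y - manifold_boundary Y"

section \<open>Smooth paths and their length\<close>

text \<open>
  Smooth means infinitely differentiable on \<open>{0..1}\<close>, with one-sided derivatives at the two
  end points; \<open>D k\<close> is the \<open>k\<close>-th derivative. The velocity is allowed to vanish.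
\<close>

definition smooth_path :: "(real \<Rightarrow> 'a::real_normed_vector) \<Rightarrow> bool" where
  "smooth_path \<gamma> \<longleftrightarrow>
     (\<exists>D :: nat \<Rightarrow> real \<Rightarrow> 'a. D 0 = \<gamma> \<and>
        (\<forall>k. \<forall>t\<in>{0..1}. (D k has_vector_derivative D (Suc k) t) (at t within {0..1})))"

text \<open>
  This is only used for smooth paths, whose speed is continuous and hence integrable.
\<close>

definition path_length :: "(real \<Rightarrow> 'a::real_normed_vector) \<Rightarrow> real" where
  "path_length \<gamma> =
     integral {0..1} (\<lambda>t. norm (vector_derivative \<gamma> (at t within {0..1})))"

section \<open>The intrinsic distance and its lower limit\<close>

text \<open>Distances take values in \<open>[0, \<infinity>]\<close>; the infimum over no paths at all is \<open>\<infinity>\<close>.\<close>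

definition smooth_path_dist :: "'a::real_normed_vector set \<Rightarrow> 'a \<Rightarrow> 'a \<Rightarrow> ennreal" where
  "smooth_path_dist S x y =
     (INF \<gamma> \<in> {\<gamma>. smooth_path \<gamma> \<and> \<gamma> ` {0..1} \<subseteq> S \<and> \<gamma> 0 = x \<and> \<gamma> 1 = y}. ennreal (path_length \<gamma>))"

text \<open>
  The filter below restricts the neighbourhoods of \<open>(x, y)\<close> to pairs of interior points.
  Unlike \<open>at (x, y) within \<dots>\<close> it does not exclude the point \<open>(x, y)\<close> itself when \<open>x\<close> and \<open>y\<close>
  are both interior.
\<close>

definition rho :: "(real ^ 'n) set \<Rightarrow> real ^ 'n \<Rightarrow> real ^ 'n \<Rightarrow> ennreal" where
  "rho Y x y =
     Liminf (inf (nhds (x, y)) (principal (manifold_interior Y \<times> manifold_interior Y)))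
       (\<lambda>(x', y'). smooth_path_dist (manifold_interior Y) x' y')"

text \<open>
  \<open>Metric_space\<close> requires nonnegativity and symmetry on the whole type, so the values outside
  \<open>Y\<close> are set to 0 in order that only the values on \<open>Y\<close> matter.
  The finiteness clause keeps \<open>enn2real\<close>, which maps \<open>\<infinity>\<close> to 0, from losing information.
\<close>

definition metric_on :: "'a set \<Rightarrow> ('a \<Rightarrow> 'a \<Rightarrow> ennreal) \<Rightarrow> bool" where
  "metric_on M d \<longleftrightarrow>
     (\<forall>x\<in>M. \<forall>y\<in>M. d x y < \<infinity>) \<and>
     Metric_space M (\<lambda>x y. if x \<in> M \<and> y \<in> M then enn2real (d x y) else 0)"

end

theory Submission
  imports Defs
begin

text \<open>
  \<open>Y\<close> is the pyramid \<open>{p. \<bar>p\<^sub>m\<bar> \<le> p\<^sub>j \<le> 1}\<close> with apex 0, sheared by a function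
  \<open>p\<^sub>k \<mapsto> p\<^sub>k + f (p\<^sub>i, p\<^sub>j)\<close>, so it is homeomorphic to a ball. The function \<open>f\<close> vanishes for
  \<open>p\<^sub>i\<close> near 0 and for \<open>p\<^sub>i\<close> near \<open>p\<^sub>j\<close>, and in between it is so strongly corrugated, along curves
  which themselves wiggle faster and faster towards the apex, that every path across
  the corrugation has length at least 4. But two boundary points on different sides
  of the corrugation are joined to the apex by segments of length at most 1 and at most 2,
  so the triangle inequality fails.
\<close>

section \<open>Balls as manifolds with boundary\<close>

text \<open>The corrugation must die out at the apex for the shear to stay continuous, yet crossing
  it must remain expensive arbitrarily close to the apex. At height u the pyramid extends at most u
  to either side in the sheared direction, so a fold of height 2u cannot be skipped and costs a
  length of order u; about 1/u folds then cost an amount bounded below. The obstacle is a path that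
  changes the ratio x / u by lowering u alone. Folds along the lines x = const would cost it next to
  nothing. Hence the folds follow the level curves of \<open>x - wiggle u\<close>: whoever keeps to
  such a curve while u is halved has to move x back and forth about 1/u times by an amount of order
  u, which again has a cost bounded below. The apex is no interior point, so no admissible path runs
  through it. The lower limit does not see this, because the segments from the apex have interior
  points arbitrarily near to it.\<close>

lemma half_space_chart_cball:
  fixes p :: "real ^ 'n"
  assumes "p \<in> cball 0 1"
  obtains k U \<phi> where "half_space_chart (cball 0 1) k U \<phi>" "p \<in> U"
proof -
  fix k :: 'n
  define e :: "real ^ 'n" where "e = axis k 1"
  have norm_e: "norm e = 1" by (simp add: e_def)
  have e_k: "e $ k = 1" by (simp add: e_def)
  have e_inner: "e \<bullet> v = v $ k" for v by (simp add: e_def inner_axis' )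
  have neg_e: "- e \<noteq> e"
  proof
    assume "- e = e"
    then have "(- e) $ k = e $ k" by (rule arg_cong)
    then show False by (simp add: e_k)
  qed
  \<comment> \<open>The sign selects a pole \<open>s *\<^sub>R e\<close> on the sphere that differs
    from \<open>p\<close>; the chart covers the ball without this pole.\<close>
  define s :: real where "s = (if p = e then -1 else 1)"
  have s: "s * s = 1" "s *\<^sub>R e \<noteq> p" "\<bar>s\<bar> = 1"
    using norm_e neg_e by (auto simp: s_def split: if_splits)
  \<comment> \<open>Inversion in the unit sphere. The map
    \<open>x \<mapsto> e - s *\<^sub>R x\<close> puts the pole at 0 and the ball at centre
    \<open>e\<close>, where it is given by \<open>norm v ^ 2 \<le> 2 * v $ k\<close>; dividing by
    \<open>norm v ^ 2\<close> turns this into the half-space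
    \<open>1 / 2 \<le> inv v $ k\<close>.\<close>
  define inv where "inv = (\<lambda>v :: real ^ 'n. inverse (norm v ^ 2) *\<^sub>R v)"
  define \<phi> where "\<phi> = (\<lambda>x. inv (e - s *\<^sub>R x) - (1/2) *\<^sub>R e)"
  define \<psi> where "\<psi> = (\<lambda>w. s *\<^sub>R (e - inv (w + (1/2) *\<^sub>R e)))"
  have norm_inv: "norm (inv v) = inverse (norm v)" for v
    by (cases "v = 0") (auto simp: inv_def power2_eq_square)
  \<comment> \<open>This includes \<open>v = 0\<close>, since \<open>inverse 0 = 0\<close>. The two
    inverse laws for \<open>\<phi>\<close> and \<open>\<psi>\<close> therefore hold at every
    point.\<close>
  have inv_inv: "inv (inv v) = v" for v
  proof (cases "v = 0")
    case False
    have "inv (inv v) = inverse (norm (inv v) ^ 2) *\<^sub>R inv v" by (simp add: inv_def)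
    also have "\<dots> = (norm v ^ 2 * inverse (norm v ^ 2)) *\<^sub>R v"
      by (simp only: norm_inv) (simp add: inv_def power_inverse)
    finally show ?thesis using False by simp
  qed (simp add: inv_def)
  have inv_0: "inv v \<noteq> 0" if "v \<noteq> 0" for v using that by (simp add: inv_def)
  have cont_inv: "continuous_on S inv" if "0 \<notin> S" for S
    unfolding inv_def using that by (intro continuous_intros) auto
  have norm_diff: "norm (e - v) ^ 2 = 1 - 2 * v $ k + norm v ^ 2" for v
    using norm_e by (simp add: power2_norm_eq_inner inner_diff_left inner_diff_right e_inner inner_commute[of v e])
       (metis e_inner e_k)
  have ball_iff: "norm (e - v) \<le> 1 \<longleftrightarrow> norm v ^ 2 \<le> 2 * v $ k" for v
  proof -
    have "norm (e - v) \<le> 1 \<longleftrightarrow> norm (e - v) ^ 2 \<le> 1"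
      by (simp add: abs_square_le_1)
    then show ?thesis by (simp add: norm_diff)
  qed
  have inv_iff: "norm v ^ 2 \<le> 2 * v $ k \<longleftrightarrow> 1 / 2 \<le> inv v $ k" if "v \<noteq> 0" for v
    using that by (simp add: inv_def field_simps)
  have ne0: "w + (1/2) *\<^sub>R e \<noteq> 0" if "0 \<le> w $ k" for w
  proof
    assume "w + (1/2) *\<^sub>R e = 0"
    then have "(w + (1/2) *\<^sub>R e) $ k = 0" by simp
    then show False using that e_k by simp
  qed
  define U where "U = cball (0 :: real ^ 'n) 1 - {s *\<^sub>R e}"
  have ne0': "e - s *\<^sub>R x \<noteq> 0" if "x \<in> U" for x
  proof
    assume "e - s *\<^sub>R x = 0"
    then have "s *\<^sub>R e = (s * s) *\<^sub>R x" by simp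
    then show False using that s by (simp add: U_def)
  qed
  have hom: "homeomorphism U {z. 0 \<le> z $ k} \<phi> \<psi>"
  proof (rule homeomorphismI)
    show "continuous_on U \<phi>" unfolding \<phi>_def
      by (intro continuous_intros continuous_on_compose2[OF cont_inv[of "-{0}"]])
        (use ne0' in auto)
    show "continuous_on {z. 0 \<le> z $ k} \<psi>" unfolding \<psi>_def
      by (intro continuous_intros continuous_on_compose2[OF cont_inv[of "-{0}"]])
        (use ne0 in auto)
    show "\<phi> ` U \<subseteq> {z. 0 \<le> z $ k}"
    proof clarsimp
      fix x assume x: "x \<in> U"
      have "norm (e - (e - s *\<^sub>R x)) \<le> 1" using x s by (simp add: U_def)
      then show "0 \<le> \<phi> x $ k"
        using inv_iff[OF ne0'[OF x]] e_k by (simp only: ball_iff) (simp add: \<phi>_def)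
    qed
    show "\<psi> ` {z. 0 \<le> z $ k} \<subseteq> U"
    proof clarsimp
      fix w :: "real ^ 'n" assume w: "0 \<le> w $ k"
      define v where "v = inv (w + (1/2) *\<^sub>R e)"
      have v0: "v \<noteq> 0" using inv_0[OF ne0[OF w]] by (simp add: v_def)
      have "1/2 \<le> inv v $ k" using w e_k by (simp add: v_def inv_inv)
      then have "norm (e - v) \<le> 1" using inv_iff[OF v0] ball_iff by simp
      moreover have "s *\<^sub>R (e - v) \<noteq> s *\<^sub>R e" using v0 s by auto
      ultimately show "\<psi> w \<in> U" using s by (simp add: \<psi>_def U_def flip: v_def)
    qed
    show "\<psi> (\<phi> x) = x" for x
      by (simp add: \<psi>_def \<phi>_def inv_inv s)
    show "\<phi> (\<psi> w) = w" for w
      by (simp add: \<psi>_def \<phi>_def inv_inv s)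
  qed
  have "openin (top_of_set (cball 0 1)) U" unfolding U_def by (simp add: openin_delete)
  moreover have "openin (top_of_set {z :: real ^ 'n. 0 \<le> z $ k}) {z. 0 \<le> z $ k}" by simp
  ultimately have "half_space_chart (cball 0 1) k U \<phi>"
    unfolding half_space_chart_def using hom by blast
  moreover have "p \<in> U" using assms s by (auto simp: U_def)
  ultimately show thesis by (rule that)
qed

lemma C0_manifold_with_boundary_homeomorphic_cball:
  fixes Y :: "(real ^ 'n) set"
  assumes "Y homeomorphic cball (0 :: real ^ 'n) 1"
  shows "C0_manifold_with_boundary Y"
  unfolding C0_manifold_with_boundary_def
proof
  fix p assume p: "p \<in> Y"
  obtain f g where fg: "homeomorphism Y (cball (0 :: real ^ 'n) 1) f g"
    using assms by (auto simp: homeomorphic_def)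
  then have "f p \<in> cball 0 1" using p by (auto simp: homeomorphism_def)
  then obtain k U \<phi> where ch: "half_space_chart (cball 0 1) k U \<phi>" and U: "f p \<in> U"
    by (rule half_space_chart_cball)
  obtain V \<psi> where op: "openin (top_of_set (cball 0 1)) U"
    and V: "openin (top_of_set {z. 0 \<le> z $ k}) V" "homeomorphism U V \<phi> \<psi>"
    using ch unfolding half_space_chart_def by blast
  have gf: "homeomorphism (cball (0 :: real ^ 'n) 1) Y g f"
    using fg by (simp add: homeomorphism_symD)
  have sub: "U \<subseteq> cball 0 1" using op by (rule openin_imp_subset)
  have "openin (top_of_set Y) (g ` U)" by (rule homeomorphism_imp_open_map[OF gf op])
  moreover have "homeomorphism U (g ` U) g f"
    using homeomorphism_of_subsets[OF gf sub subset_refl refl] .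
  then have "homeomorphism (g ` U) U f g" by (rule homeomorphism_symD)
  then have "homeomorphism (g ` U) V (\<phi> \<circ> f) (g \<circ> \<psi>)"
    using V(2) by (rule homeomorphism_compose)
  ultimately have "half_space_chart Y k (g ` U) (\<phi> \<circ> f)"
    unfolding half_space_chart_def using V(1) by blast
  moreover have "p \<in> g ` U" using U p fg by (metis homeomorphism_apply1 imageI)
  ultimately show "\<exists>k U \<phi>. half_space_chart Y k U \<phi> \<and> p \<in> U" by blast
qed

text \<open>Invariance of domain in both directions. A chart value off the hyperplane has a
  neighbourhood whose preimage is open in the whole space. Conversely, a chart sends a neighbourhood
  of a point of \<open>interior Y\<close> to an open set, and an open set inside a half-space cannot
  touch its hyperplane.\<close>

lemma manifold_interior_eq_interior:
  fixes Y :: "(real ^ 'n) set"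
  assumes "C0_manifold_with_boundary Y"
  shows "manifold_interior Y = interior Y"
proof (intro equalityI subsetI)
  fix p assume p: "p \<in> manifold_interior Y"
  then have pY: "p \<in> Y" by (simp add: manifold_interior_def)
  then obtain k U \<phi> where ch: "half_space_chart Y k U \<phi>" and U: "p \<in> U"
    using assms unfolding C0_manifold_with_boundary_def by blast
  obtain V \<psi> where op: "openin (top_of_set Y) U"
    and V: "openin (top_of_set {z. 0 \<le> z $ k}) V" and hom: "homeomorphism U V \<phi> \<psi>"
    using ch unfolding half_space_chart_def by blast
  have "\<phi> p $ k \<noteq> 0" using p ch U pY by (auto simp: manifold_interior_def manifold_boundary_def)
  moreover have "\<phi> p \<in> V" using hom U by (auto simp: homeomorphism_def)
  moreover have "V \<subseteq> {z. 0 \<le> z $ k}" using V by (rule openin_imp_subset)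
  ultimately have pos: "\<phi> p \<in> V \<inter> {z. 0 < z $ k}" by force
  obtain T where T: "open T" "V = {z. 0 \<le> z $ k} \<inter> T" using V by (auto simp: openin_open)
  have "V \<inter> {z. 0 < z $ k} = T \<inter> {z. 0 < z $ k}" using T by auto
  moreover have "open {z :: real ^ 'n. 0 < z $ k}"
    by (intro open_Collect_less continuous_intros)
  ultimately have "open (V \<inter> {z. 0 < z $ k})" using T by auto
  moreover have "continuous_on (V \<inter> {z. 0 < z $ k}) \<psi>"
    using hom by (auto simp: homeomorphism_def intro: continuous_on_subset)
  moreover have "inj_on \<psi> (V \<inter> {z. 0 < z $ k})"
    using hom by (auto simp: homeomorphism_def intro!: inj_on_inverseI[of _ \<phi>])
  ultimately have "open (\<psi> ` (V \<inter> {z. 0 < z $ k}))" by (simp add: invariance_of_domain)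
  moreover have "\<psi> ` (V \<inter> {z. 0 < z $ k}) \<subseteq> Y"
    using hom openin_imp_subset[OF op] by (auto simp: homeomorphism_def)
  moreover have "p \<in> \<psi> ` (V \<inter> {z. 0 < z $ k})"
    using pos hom U by (metis homeomorphism_apply1 imageI)
  ultimately show "p \<in> interior Y" by (meson interior_maximal subsetD)
next
  fix p assume p: "p \<in> interior Y"
  then have pY: "p \<in> Y" using interior_subset by blast
  have "p \<notin> manifold_boundary Y"
  proof
    assume "p \<in> manifold_boundary Y"
    then obtain k U \<phi> where ch: "half_space_chart Y k U \<phi>" and U: "p \<in> U" and 0: "\<phi> p $ k = 0"
      by (auto simp: manifold_boundary_def)
    obtain V \<psi> where op: "openin (top_of_set Y) U"
      and V: "openin (top_of_set {z. 0 \<le> z $ k}) V" and hom: "homeomorphism U V \<phi> \<psi>"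
      using ch unfolding half_space_chart_def by blast
    obtain T where T: "open T" "U = Y \<inter> T" using op by (auto simp: openin_open)
    define W where "W = T \<inter> interior Y"
    have WU: "W \<subseteq> U" using T interior_subset by (auto simp: W_def)
    have "open (\<phi> ` W)"
    proof (rule invariance_of_domain)
      show "continuous_on W \<phi>" using hom WU by (auto simp: homeomorphism_def intro: continuous_on_subset)
      show "open W" using T by (auto simp: W_def)
      show "inj_on \<phi> W" using hom WU by (auto simp: homeomorphism_def intro!: inj_on_inverseI[of _ \<psi>])
    qed
    moreover have "\<phi> p \<in> \<phi> ` W" using U T p by (auto simp: W_def)
    ultimately obtain d where d: "d > 0" "cball (\<phi> p) d \<subseteq> \<phi> ` W"
      by (auto simp: open_contains_cball)
    have "\<phi> p - d *\<^sub>R axis k 1 \<in> cball (\<phi> p) d" using d by (simp add: dist_norm)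
    moreover have "\<phi> ` W \<subseteq> {z. 0 \<le> z $ k}"
      using WU hom openin_imp_subset[OF V] by (auto simp: homeomorphism_def)
    ultimately have "\<phi> p - d *\<^sub>R axis k 1 \<in> {z. 0 \<le> z $ k}" using d by blast
    then show False using d 0 by simp
  qed
  then show "p \<in> manifold_interior Y" using pY by (simp add: manifold_interior_def)
qed

section \<open>Smooth and Lipschitz paths\<close>

text \<open>De Casteljau's recursion; the control points are \<open>c 0, \<dots>, c n\<close>.\<close>

fun bernstein_poly :: "nat \<Rightarrow> (nat \<Rightarrow> 'a::real_vector) \<Rightarrow> real \<Rightarrow> 'a" where
  "bernstein_poly 0 c t = c 0"
| "bernstein_poly (Suc n) c t =
     (1 - t) *\<^sub>R bernstein_poly n c t + t *\<^sub>R bernstein_poly n (\<lambda>k. c (Suc k)) t"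

lemma bernstein_poly_0: "bernstein_poly n c 0 = c 0"
  by (induction n arbitrary: c) auto

lemma bernstein_poly_1: "bernstein_poly n c 1 = c n"
  by (induction n arbitrary: c) auto

lemma bernstein_poly_diff:
  "bernstein_poly n (\<lambda>k. c k - d k) t = bernstein_poly n c t - bernstein_poly n d t"
proof (induction n arbitrary: c d)
  case (Suc n)
  show ?case by (simp only: bernstein_poly.simps Suc) (simp add: algebra_simps)
qed simp

lemma bernstein_poly_add:
  "bernstein_poly n (\<lambda>k. c k + d k) t = bernstein_poly n c t + bernstein_poly n d t"
  by (induction n arbitrary: c d) (auto simp: algebra_simps)

lemma bernstein_poly_cmult:
  fixes c :: "nat \<Rightarrow> real"
  shows "bernstein_poly n (\<lambda>k. a * c k) t = a * bernstein_poly n c t"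
  by (induction n arbitrary: c) (auto simp: algebra_simps)

lemma bernstein_poly_const: "bernstein_poly n (\<lambda>k. c) t = c"
  by (induction n) (auto simp flip: scaleR_left_distrib)

text \<open>For \<open>t\<close> in \<open>[0, 1]\<close> the value is a convex combination of the
  control points, with weights that do not depend on them.\<close>

lemma norm_bernstein_poly_le:
  fixes c :: "nat \<Rightarrow> 'a::real_normed_vector"
  assumes t: "0 \<le> t" "t \<le> 1"
  shows "(\<And>k. k \<le> n \<Longrightarrow> norm (c k) \<le> d k) \<Longrightarrow> norm (bernstein_poly n c t) \<le> bernstein_poly n d t"
proof (induction n arbitrary: c d)
  case (Suc n)
  have "norm (bernstein_poly (Suc n) c t) \<le>
    norm ((1 - t) *\<^sub>R bernstein_poly n c t) + norm (t *\<^sub>R bernstein_poly n (\<lambda>k. c (Suc k)) t)"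
    by (simp only: bernstein_poly.simps norm_triangle_ineq)
  also have "\<dots> \<le> (1 - t) *\<^sub>R bernstein_poly n d t + t *\<^sub>R bernstein_poly n (\<lambda>k. d (Suc k)) t"
    using Suc.IH[of c d] Suc.IH[of "\<lambda>k. c (Suc k)" "\<lambda>k. d (Suc k)"] Suc.prems t
    by (auto intro!: add_mono mult_left_mono)
  finally show ?case by simp
qed auto

text \<open>The second moment of the binomial distribution. The shift \<open>a\<close> lets the
  induction absorb the index shift in the recursion; \<open>a = - (n * t)\<close> gives the
  variance.\<close>

lemma bernstein_poly_square:
  "bernstein_poly n (\<lambda>k. (real k + a) ^ 2) t = (real n * t + a) ^ 2 + real n * t * (1 - t)"
proof (induction n arbitrary: a)
  case (Suc n)
  have "(\<lambda>k. (real (Suc k) + a) ^ 2) = (\<lambda>k. (real k + (a + 1)) ^ 2)" by (auto simp: algebra_simps)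
  then show ?case unfolding bernstein_poly.simps Suc by (simp only: Suc) (simp add: power2_eq_square algebra_simps)
qed simp

lemma polynomial_function_bernstein_poly:
  fixes c :: "nat \<Rightarrow> 'a::euclidean_space"
  shows "polynomial_function (bernstein_poly n c)"
proof (induction n arbitrary: c)
  case (Suc n)
  have "polynomial_function (\<lambda>t. (1 - t) *\<^sub>R bernstein_poly n c t + t *\<^sub>R bernstein_poly n (\<lambda>k. c (Suc k)) t)"
    using Suc by (intro polynomial_function_add polynomial_function_mult polynomial_function_diff) auto
  then show ?case by simp
next
  case 0
  have "bernstein_poly 0 c = (\<lambda>t. c 0)" by auto
  then show ?case by simp
qed

text \<open>The control points of the derivative are \<open>n\<close> times the differences of
  neighbouring ones, so for samples at spacing \<open>1 / n\<close> they are bounded by a Lipschitz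
  constant. For \<open>n = 0\<close> the factor \<open>real n\<close> makes the truncated
  \<open>n - 1\<close> harmless.\<close>

lemma has_vector_derivative_bernstein_poly:
  "(bernstein_poly n c has_vector_derivative
     real n *\<^sub>R bernstein_poly (n - 1) (\<lambda>k. c (Suc k) - c k) t) (at t within S)"
proof (induction n arbitrary: c)
  case 0
  have "bernstein_poly 0 c = (\<lambda>t. c 0)" by auto
  then show ?case by simp
next
  case (Suc n)
  let ?D = "\<lambda>n c. bernstein_poly n (\<lambda>k. c (Suc k) - c k) t"
  let ?c = "\<lambda>k. c (Suc k)"
  have eq: "bernstein_poly (Suc n) c = (\<lambda>t. (1 - t) *\<^sub>R bernstein_poly n c t + t *\<^sub>R bernstein_poly n ?c t)"
    by auto
  have "(bernstein_poly (Suc n) c has_vector_derivative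
     (1 - t) *\<^sub>R (real n *\<^sub>R ?D (n - 1) c) + (- 1) *\<^sub>R bernstein_poly n c t
      + (t *\<^sub>R (real n *\<^sub>R ?D (n - 1) ?c) + 1 *\<^sub>R bernstein_poly n ?c t)) (at t within S)"
    unfolding eq
    by (intro has_vector_derivative_add has_vector_derivative_scaleR Suc)
      (auto intro!: derivative_eq_intros)
  also have "(1 - t) *\<^sub>R (real n *\<^sub>R ?D (n - 1) c) + (- 1) *\<^sub>R bernstein_poly n c t
      + (t *\<^sub>R (real n *\<^sub>R ?D (n - 1) ?c) + 1 *\<^sub>R bernstein_poly n ?c t)
    = real n *\<^sub>R ((1 - t) *\<^sub>R ?D (n - 1) c + t *\<^sub>R ?D (n - 1) ?c) + ?D n c"
    by (simp add: bernstein_poly_diff algebra_simps)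
  also have "real n *\<^sub>R ((1 - t) *\<^sub>R ?D (n - 1) c + t *\<^sub>R ?D (n - 1) ?c) = real n *\<^sub>R ?D n c"
    by (cases n) auto
  finally show ?case by (simp add: algebra_simps)
qed

lemma smooth_path_polynomial_function:
  fixes p :: "real \<Rightarrow> 'a::euclidean_space"
  assumes "polynomial_function p"
  shows "smooth_path p"
proof -
  have "\<forall>q\<in>Collect polynomial_function. \<exists>q'. q' \<in> Collect polynomial_function \<and>
      (\<forall>t. ((q :: real \<Rightarrow> 'a) has_vector_derivative q' t) (at t))"
    by (metis has_vector_derivative_polynomial_function mem_Collect_eq)
  \<comment> \<open>One derivative is chosen for every polynomial function at once; its iterates on
    \<open>p\<close> form the sequence of higher derivatives.\<close>
  then obtain \<delta> where \<delta>: "\<And>q. polynomial_function (q :: real \<Rightarrow> 'a) \<Longrightarrow> polynomial_function (\<delta> q) \<and>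
      (\<forall>t. (q has_vector_derivative \<delta> q t) (at t))"
    unfolding bchoice_iff by auto
  have "polynomial_function ((\<delta> ^^ k) p)" for k
    by (induction k) (use assms \<delta> in auto)
  then show ?thesis
    unfolding smooth_path_def using \<delta>
    by (intro exI[of _ "\<lambda>k. (\<delta> ^^ k) p"]) (auto intro: has_vector_derivative_at_within)
qed

text \<open>Chebyshev's argument. The estimate \<open>\<bar>d\<bar> \<le> e + d ^ 2 / e\<close>
  replaces the split into near and far sample points, and averaging it leaves the variance
  \<open>t * (1 - t) / n\<close>, which is at most \<open>1 / n\<close>.\<close>

lemma bernstein_poly_approx:
  fixes \<gamma> :: "real \<Rightarrow> 'a::euclidean_space"
  assumes lip: "L-lipschitz_on {0..1} \<gamma>" and n: "n > 0" and t: "0 \<le> t" "t \<le> 1"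
    and e: "e > 0"
  shows "norm (bernstein_poly n (\<lambda>k. \<gamma> (real k / real n)) t - \<gamma> t) \<le> L * (e + 1 / (e * real n))"
proof -
  have L: "0 \<le> L" using lip by (rule lipschitz_on_nonneg)
  have pw: "norm (\<gamma> (real k / real n) - \<gamma> t) \<le> L * (e + 1 / (e * real n ^ 2) * (real k + - (real n * t)) ^ 2)"
    if k: "k \<le> n" for k
  proof -
    define d where "d = real k / real n - t"
    have d2: "d ^ 2 = (real k + - (real n * t)) ^ 2 / real n ^ 2"
      using n by (simp add: d_def field_simps)
    have "\<bar>d\<bar> * e \<le> e ^ 2 + d ^ 2"
    proof -
      have "0 \<le> (\<bar>d\<bar> - e)^2 + d^2 + e^2" by simp
      also have "\<dots> = 2 * (e^2 + d^2 - \<bar>d\<bar> * e)" by (simp add: power2_eq_square algebra_simps)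
      finally show ?thesis by simp
    qed
    then have "\<bar>d\<bar> \<le> e + d ^ 2 / e" using e by (simp add: field_simps power2_eq_square)
    also have "\<dots> = e + 1 / (e * real n ^ 2) * (real k + - (real n * t)) ^ 2"
      unfolding d2 by simp
    finally have "L * \<bar>d\<bar> \<le> L * (e + 1 / (e * real n ^ 2) * (real k + - (real n * t)) ^ 2)"
      using L by (rule mult_left_mono)
    moreover have "norm (\<gamma> (real k / real n) - \<gamma> t) \<le> L * \<bar>d\<bar>"
      using lipschitz_on_normD[OF lip, of "real k / real n" t] k t n by (simp add: d_def)
    ultimately show ?thesis by linarith
  qed
  have "norm (bernstein_poly n (\<lambda>k. \<gamma> (real k / real n)) t - \<gamma> t)
      = norm (bernstein_poly n (\<lambda>k. \<gamma> (real k / real n) - \<gamma> t) t)"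
    by (simp add: bernstein_poly_diff bernstein_poly_const)
  also have "\<dots> \<le> bernstein_poly n (\<lambda>k. L * (e + 1 / (e * real n ^ 2) * (real k + - (real n * t)) ^ 2)) t"
    using t pw by (rule norm_bernstein_poly_le)
  also have "\<dots> = L * (e + 1 / (e * real n ^ 2) * (real n * t * (1 - t)))"
    unfolding bernstein_poly_cmult bernstein_poly_add bernstein_poly_const bernstein_poly_square by simp
  also have "\<dots> \<le> L * (e + 1 / (e * real n ^ 2) * (real n * 1 * 1))"
    using t L e n by (intro mult_left_mono add_left_mono mult_mono) auto
  also have "\<dots> = L * (e + 1 / (e * real n))" using n by (simp add: power2_eq_square)
  finally show ?thesis .
qed

text \<open>Bernstein approximation does not increase the Lipschitz constant and keeps the end points.\<close>

lemma smooth_path_dist_le_lipschitz: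
  fixes \<gamma> :: "real \<Rightarrow> 'a::euclidean_space"
  assumes lip: "L-lipschitz_on {0..1} \<gamma>" and S: "open S" "\<gamma> ` {0..1} \<subseteq> S"
  shows "smooth_path_dist S (\<gamma> 0) (\<gamma> 1) \<le> ennreal L"
proof -
  have L: "0 \<le> L" using lip by (rule lipschitz_on_nonneg)
  have "compact (\<gamma> ` {0..1})"
    by (intro compact_continuous_image lipschitz_on_continuous_on[OF lip]) auto
  then obtain d where d: "d > 0" "(\<Union>x\<in>\<gamma> ` {0..1}. ball x d) \<subseteq> S"
    using S by (rule compact_subset_open_imp_ball_epsilon_subset)
  \<comment> \<open>With \<open>n > 1 / e ^ 2\<close> the error is at most \<open>2 * L * e\<close>,
    hence at most \<open>2 * d / 3\<close>. The summand 1 in \<open>L + 1\<close> covers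
    \<open>L = 0\<close>.\<close>
  define e where "e = d / (3 * (L + 1))"
  have e: "e > 0" using d L by (simp add: e_def)
  obtain n where n: "1 / e ^ 2 < real n" using reals_Archimedean2 by blast
  have n0: "n > 0" using n e by (metis less_numeral_extra(3) of_nat_0_less_iff order_less_trans zero_less_divide_1_iff zero_less_power)
  have "1 / (e * real n) \<le> e" using n n0 e by (simp add: field_simps power2_eq_square)
  then have "L * (e + 1 / (e * real n)) \<le> L * (2 * e)" using L by (intro mult_left_mono) auto
  also have "\<dots> \<le> (L + 1) * (2 * e)" using e by (intro mult_right_mono) auto
  also have "\<dots> = 2 * d / 3" using L by (simp add: e_def field_simps)
  also have "\<dots> < d" using d by simp
  finally have small: "L * (e + 1 / (e * real n)) < d" .
  define \<beta> where "\<beta> = bernstein_poly n (\<lambda>k. \<gamma> (real k / real n))"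
  define \<beta>' where "\<beta>' = (\<lambda>t. real n *\<^sub>R bernstein_poly (n - 1) (\<lambda>k. \<gamma> (real (Suc k) / real n) - \<gamma> (real k / real n)) t)"
  have der: "(\<beta> has_vector_derivative \<beta>' t) (at t within T)" for t T
    unfolding \<beta>_def \<beta>'_def by (rule has_vector_derivative_bernstein_poly)
  have norm_le: "norm (\<beta>' t) \<le> L" if t: "0 \<le> t" "t \<le> 1" for t
  proof -
    have "norm (\<beta>' t) \<le> real n * bernstein_poly (n - 1) (\<lambda>k. L / real n) t"
      unfolding \<beta>'_def norm_scaleR abs_of_nat
    proof (intro mult_left_mono norm_bernstein_poly_le t)
      fix k assume k: "k \<le> n - 1"
      have "norm (\<gamma> (real (Suc k) / real n) - \<gamma> (real k / real n)) \<le> L * norm (real (Suc k) / real n - real k / real n)"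
        using k n0 by (intro lipschitz_on_normD[OF lip]) auto
      also have "real (Suc k) / real n - real k / real n = 1 / real n" by (simp add: diff_divide_distrib[symmetric])
      finally show "norm (\<gamma> (real (Suc k) / real n) - \<gamma> (real k / real n)) \<le> L / real n" by simp
    qed auto
    then show ?thesis using n0 by (simp add: bernstein_poly_const)
  qed
  have poly: "polynomial_function \<beta>" unfolding \<beta>_def by (rule polynomial_function_bernstein_poly)
  have "path_length \<beta> \<le> L"
  proof -
    have "path_length \<beta> = integral {0..1} (\<lambda>t. norm (\<beta>' t))"
      unfolding path_length_def
      by (intro integral_cong) (auto simp: vector_derivative_within_closed_interval[OF _ _ der])
    also have "\<dots> \<le> integral {0..1} (\<lambda>t::real. L)"
    proof (intro integral_le)
      show "(\<lambda>t. norm (\<beta>' t)) integrable_on {0..1}"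
        unfolding \<beta>'_def
        by (intro integrable_continuous_interval continuous_intros
           continuous_on_polymonial_function polynomial_function_bernstein_poly)
    qed (use norm_le in auto)
    finally show ?thesis by simp
  qed
  moreover have "\<beta> ` {0..1} \<subseteq> S"
  proof clarify
    fix t :: real assume t: "t \<in> {0..1}"
    have "norm (\<beta> t - \<gamma> t) < d"
      using bernstein_poly_approx[OF lip n0 _ _ e, of t] t small unfolding \<beta>_def by auto
    then have "\<beta> t \<in> ball (\<gamma> t) d" by (simp add: dist_norm norm_minus_commute)
    then show "\<beta> t \<in> S" using d t by blast
  qed
  moreover have "\<beta> 0 = \<gamma> 0" "\<beta> 1 = \<gamma> 1" using n0 by (auto simp: \<beta>_def bernstein_poly_0 bernstein_poly_1)
  ultimately have "smooth_path_dist S (\<gamma> 0) (\<gamma> 1) \<le> ennreal (path_length \<beta>)"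
    unfolding smooth_path_dist_def using smooth_path_polynomial_function[OF poly]
    by (intro INF_lower) auto
  also have "\<dots> \<le> ennreal L" using \<open>path_length \<beta> \<le> L\<close> by (rule ennreal_leI)
  finally show ?thesis .
qed

text \<open>\<open>\<l>\<close> is the arc length run through so far. With it the lower bound for
  crossings needs only continuous coordinates and a function dominating their increments, no
  derivatives.\<close>

lemma smooth_path_arc_length:
  fixes \<gamma> :: "real \<Rightarrow> 'a::euclidean_space"
  assumes "smooth_path \<gamma>"
  obtains \<l> where "\<And>s t. 0 \<le> s \<Longrightarrow> s \<le> t \<Longrightarrow> t \<le> 1 \<Longrightarrow> norm (\<gamma> t - \<gamma> s) \<le> \<l> t - \<l> s"
    and "\<l> 1 - \<l> 0 = path_length \<gamma>" and "continuous_on {0..1} \<gamma>"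
proof -
  obtain D where D: "D 0 = \<gamma>"
    "\<And>k t. t \<in> {0..1} \<Longrightarrow> (D k has_vector_derivative D (Suc k) t) (at t within {0..1})"
    using assms unfolding smooth_path_def by blast
  define \<gamma>' where "\<gamma>' = D 1"
  have der: "(\<gamma> has_vector_derivative \<gamma>' t) (at t within {0..1})" if "t \<in> {0..1}" for t
    using D(2)[OF that, of 0] D(1) by (simp add: \<gamma>'_def)
  have cont: "continuous_on {0..1} (D k)" for k
    using D(2) by (meson continuous_on_eq_continuous_within has_vector_derivative_continuous)
  have int: "(\<lambda>t. norm (\<gamma>' t)) integrable_on {a..b}" "\<gamma>' integrable_on {a..b}"
    if "0 \<le> a" "b \<le> 1" for a b
    using that cont[of 1] unfolding \<gamma>'_def
    by (auto intro!: integrable_continuous_interval continuous_on_norm intro: continuous_on_subset)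
  define \<l> where "\<l> = (\<lambda>t. integral {0..t} (\<lambda>t. norm (\<gamma>' t)))"
  show thesis
  proof
    show "continuous_on {0..1} \<gamma>" using cont[of 0] D(1) by simp
    have "vector_derivative \<gamma> (at t within {0..1}) = \<gamma>' t" if "t \<in> {0..1}" for t
      by (rule vector_derivative_within_closed_interval[OF zero_less_one that der[OF that]])
    then have "path_length \<gamma> = integral {0..1} (\<lambda>t. norm (\<gamma>' t))"
      unfolding path_length_def by (intro integral_cong) simp
    then show "\<l> 1 - \<l> 0 = path_length \<gamma>" by (simp add: \<l>_def)
    fix s t :: real assume st: "0 \<le> s" "s \<le> t" "t \<le> 1"
    have "(\<gamma>' has_integral \<gamma> t - \<gamma> s) {s..t}"
      using st by (intro fundamental_theorem_of_calculus has_vector_derivative_within_subset[OF der]) auto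
    then have "norm (\<gamma> t - \<gamma> s) = norm (integral {s..t} \<gamma>')" by (simp add: integral_unique)
    also have "\<dots> \<le> integral {s..t} (\<lambda>t. norm (\<gamma>' t))"
      using st by (intro integral_norm_bound_integral int) auto
    also have "\<dots> = \<l> t - \<l> s"
      using Henstock_Kurzweil_Integration.integral_combine[OF st(1,2) int(1)[of 0 t]] st
      by (simp add: \<l>_def)
    finally show "norm (\<gamma> t - \<gamma> s) \<le> \<l> t - \<l> s" .
  qed
qed

text \<open>The end points may lie on the boundary. A lower limit needs only some interior pairs
  arbitrarily close to them, and \<open>\<gamma>\<close> supplies these once a short piece is cut
  off at both ends; stretching the rest over \<open>{0..1}\<close> does not raise the Lipschitz
  constant.\<close>

lemma rho_le_lipschitz:
  fixes \<gamma> :: "real \<Rightarrow> real ^ 'n"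
  assumes lip: "L-lipschitz_on {0..1} \<gamma>" and op: "open (manifold_interior Y)"
    and int: "\<And>t. 0 < t \<Longrightarrow> t < 1 \<Longrightarrow> \<gamma> t \<in> manifold_interior Y"
  shows "rho Y (\<gamma> 0) (\<gamma> 1) \<le> ennreal L"
  unfolding rho_def
proof (rule Liminf_least)
  let ?I = "manifold_interior Y"
  fix P assume "eventually P (inf (nhds (\<gamma> 0, \<gamma> 1)) (principal (?I \<times> ?I)))"
  then have P: "eventually (\<lambda>z. z \<in> ?I \<times> ?I \<longrightarrow> P z) (nhds (\<gamma> 0, \<gamma> 1))"
    by (simp add: eventually_inf_principal)
  have cont: "continuous_on {0..1} \<gamma>" using lip by (rule lipschitz_on_continuous_on)
  \<comment> \<open>The offset 3 keeps \<open>s n\<close> below \<open>1 / 2\<close>, so that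
    \<open>s n < 1 - s n\<close>.\<close>
  define s :: "nat \<Rightarrow> real" where "s = (\<lambda>n. inverse (real (n + 3)))"
  have s: "0 < s n" "s n < 1/2" for n by (auto simp: s_def field_simps)
  have s_le: "0 \<le> s n" "s n \<le> 1" for n by (auto simp: s_def field_simps)
  have s0: "s \<longlonglongrightarrow> 0"
    unfolding s_def by (rule LIMSEQ_ignore_initial_segment[OF lim_inverse_n])
  have "(\<lambda>n. \<gamma> (s n)) \<longlonglongrightarrow> \<gamma> 0"
    using s_le by (intro continuous_on_tendsto_compose[OF cont s0] always_eventually) auto
  moreover have "(\<lambda>n. 1 - s n) \<longlonglongrightarrow> 1" using tendsto_diff[OF tendsto_const s0, of 1] by simp
  then have "(\<lambda>n. \<gamma> (1 - s n)) \<longlonglongrightarrow> \<gamma> 1"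
    using s_le by (intro continuous_on_tendsto_compose[OF cont] always_eventually) auto
  ultimately have "(\<lambda>n. (\<gamma> (s n), \<gamma> (1 - s n))) \<longlonglongrightarrow> (\<gamma> 0, \<gamma> 1)" by (rule tendsto_Pair)
  then have "eventually (\<lambda>n. (\<gamma> (s n), \<gamma> (1 - s n)) \<in> ?I \<times> ?I \<longrightarrow> P (\<gamma> (s n), \<gamma> (1 - s n))) sequentially"
    using P by (auto simp: filterlim_iff)
  then obtain n where n: "(\<gamma> (s n), \<gamma> (1 - s n)) \<in> ?I \<times> ?I \<Longrightarrow> P (\<gamma> (s n), \<gamma> (1 - s n))"
    by (auto simp: eventually_sequentially)
  define r where "r = s n"
  have r: "0 < r" "r < 1/2" using s by (auto simp: r_def)
  have "\<gamma> r \<in> ?I" "\<gamma> (1 - r) \<in> ?I" using r int[of r] int[of "1 - r"] by auto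
  then have Pr: "P (\<gamma> r, \<gamma> (1 - r))" using n by (simp add: r_def)
  have mem: "r + (1 - 2 * r) * t \<in> {r..1 - r}" if "t \<in> {0..1}" for t
  proof -
    have "(1 - 2 * r) * t \<le> (1 - 2 * r) * 1" "0 \<le> (1 - 2 * r) * t"
      using that r by (intro mult_left_mono mult_nonneg_nonneg; simp)+
    then show ?thesis by (simp del: mult_le_cancel_left2)
  qed
  have "L-lipschitz_on {0..1} (\<lambda>t. \<gamma> (r + (1 - 2 * r) * t))"
  proof (rule lipschitz_onI)
    show "0 \<le> L" using lip by (rule lipschitz_on_nonneg)
    fix t u :: real assume tu: "t \<in> {0..1}" "u \<in> {0..1}"
    have "dist (\<gamma> (r + (1 - 2 * r) * t)) (\<gamma> (r + (1 - 2 * r) * u))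
       \<le> L * dist (r + (1 - 2 * r) * t) (r + (1 - 2 * r) * u)"
      using mem[OF tu(1)] mem[OF tu(2)] r by (intro lipschitz_onD[OF lip]) auto
    also have "dist (r + (1 - 2 * r) * t) (r + (1 - 2 * r) * u) = (1 - 2 * r) * dist t u"
      using r by (simp add: dist_real_def abs_mult flip: right_diff_distrib)
    also have "\<dots> \<le> 1 * dist t u" using r by (intro mult_right_mono) auto
    finally show "dist (\<gamma> (r + (1 - 2 * r) * t)) (\<gamma> (r + (1 - 2 * r) * u)) \<le> L * dist t u"
      using \<open>0 \<le> L\<close> by (simp add: mult_left_mono)
  qed
  moreover have "(\<lambda>t. \<gamma> (r + (1 - 2 * r) * t)) ` {0..1} \<subseteq> ?I"
  proof clarify
    fix t :: real assume "t \<in> {0..1}"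
    from mem[OF this] show "\<gamma> (r + (1 - 2 * r) * t) \<in> ?I" using r by (intro int) auto
  qed
  ultimately have "smooth_path_dist ?I (\<gamma> r) (\<gamma> (1 - r)) \<le> ennreal L"
    using smooth_path_dist_le_lipschitz[of L "\<lambda>t. \<gamma> (r + (1 - 2 * r) * t)", OF _ op] by simp
  with Pr show "(INF x\<in>Collect P. case x of (x', y') \<Rightarrow> smooth_path_dist ?I x' y') \<le> ennreal L"
    by (intro INF_lower2[of "(\<gamma> r, \<gamma> (1 - r))"]) auto
qed

section \<open>The corrugation\<close>

lemma monotone_crossing:
  fixes g \<l> :: "real \<Rightarrow> real"
  assumes g: "continuous_on {a..b} g" and mono: "\<And>s t. a \<le> s \<Longrightarrow> s \<le> t \<Longrightarrow> t \<le> b \<Longrightarrow> \<l> s \<le> \<l> t"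
    and m: "g a \<le> of_int m"
    and jump: "\<And>s t k. a \<le> s \<Longrightarrow> s < t \<Longrightarrow> t \<le> b \<Longrightarrow> m \<le> k \<Longrightarrow> k < m + int n \<Longrightarrow>
       g s = of_int k \<Longrightarrow> g t = of_int (k + 1) \<Longrightarrow> \<delta> \<le> \<l> t - \<l> s"
  shows "a \<le> t \<Longrightarrow> t \<le> b \<Longrightarrow> g t = of_int (m + int n) \<Longrightarrow> real n * \<delta> \<le> \<l> t - \<l> a"
  using jump
proof (induction n arbitrary: t)
  case 0
  then show ?case using mono[of a t] by simp
next
  case (Suc n)
  \<comment> \<open>Before reaching the top level the function attains the previous one; the costs
    before and after that time add up.\<close>
  have "\<exists>s\<ge>a. s \<le> t \<and> g s = of_int (m + int n)"
    using m Suc.prems(1-3) by (intro IVT' continuous_on_subset[OF g]) auto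
  then obtain s where s: "a \<le> s" "s \<le> t" "g s = of_int (m + int n)" by blast
  with Suc.prems(3) have "s < t" by (cases "s = t") auto
  have "real n * \<delta> \<le> \<l> s - \<l> a"
    by (rule Suc.IH) (use s Suc.prems in auto)
  moreover have "\<delta> \<le> \<l> t - \<l> s"
    by (rule Suc.prems(4)[of s t "m + int n"]) (use s \<open>s < t\<close> Suc.prems in auto)
  ultimately show ?case by (simp add: algebra_simps)
qed

text \<open>The 2 pays for rounding \<open>g a\<close> up and \<open>g b\<close> down. It also makes
  the bound trivial if no integer lies between them.\<close>

lemma crossing_length_increasing:
  fixes g \<l> :: "real \<Rightarrow> real"
  assumes ab: "a \<le> b" and g: "continuous_on {a..b} g"
    and mono: "\<And>s t. a \<le> s \<Longrightarrow> s \<le> t \<Longrightarrow> t \<le> b \<Longrightarrow> \<l> s \<le> \<l> t"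
    and \<delta>: "0 \<le> \<delta>" and le: "g a \<le> g b"
    and jump: "\<And>s t k. a \<le> s \<Longrightarrow> s < t \<Longrightarrow> t \<le> b \<Longrightarrow> g a \<le> of_int k \<Longrightarrow> of_int (k + 1) \<le> g b \<Longrightarrow>
       g s = of_int k \<Longrightarrow> g t = of_int (k + 1) \<Longrightarrow> \<delta> \<le> \<l> t - \<l> s"
  shows "(g b - g a - 2) * \<delta> \<le> \<l> b - \<l> a"
proof (cases "\<lceil>g a\<rceil> \<le> \<lfloor>g b\<rfloor>")
  case True
  define m where "m = \<lceil>g a\<rceil>"
  define n where "n = nat (\<lfloor>g b\<rfloor> - m)"
  have n: "\<lfloor>g b\<rfloor> = m + int n" using True by (simp add: n_def m_def)
  have m: "g a \<le> of_int m" by (simp add: m_def)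
  have top: "of_int (m + int n) \<le> g b" by (metis n of_int_floor_le)
  have "\<exists>t\<ge>a. t \<le> b \<and> g t = of_int (m + int n)"
  proof (rule IVT'[OF _ top ab g])
    have "m \<le> m + int n" by simp
    with m show "g a \<le> of_int (m + int n)" by linarith
  qed
  then obtain t where t: "a \<le> t" "t \<le> b" "g t = of_int (m + int n)" by blast
  have "real n * \<delta> \<le> \<l> t - \<l> a"
  proof (rule monotone_crossing[OF g mono m _ t])
    fix s t k assume "a \<le> s" "s < t" "t \<le> b" "m \<le> k" "k < m + int n"
      "g s = of_int k" "g t = of_int (k + 1)"
    moreover from this have "of_int m \<le> (of_int k :: real)" "of_int (k + 1) \<le> (of_int (m + int n) :: real)"
      unfolding of_int_le_iff by auto
    ultimately show "\<delta> \<le> \<l> t - \<l> s" using m top by (intro jump) auto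
  qed
  moreover have "\<l> t \<le> \<l> b" using mono t by simp
  moreover have "(g b - g a - 2) * \<delta> \<le> real n * \<delta>"
  proof (rule mult_right_mono[OF _ \<delta>])
    have "g b < of_int (m + int n) + 1" "of_int m < g a + 1"
      using n by (auto simp: m_def) linarith+
    then show "g b - g a - 2 \<le> real n" by simp
  qed
  ultimately show ?thesis by linarith
next
  case False
  then have "g b - g a - 2 \<le> 0" by linarith
  then have "(g b - g a - 2) * \<delta> \<le> 0" using \<delta> by (rule mult_nonpos_nonneg)
  then show ?thesis using mono[of a b] ab by simp
qed

text \<open>Stating a step through the unordered pair of its values covers rising and falling alike,
  so a decreasing \<open>g\<close> reduces to \<open>- g\<close>. The range condition in
  \<open>jump\<close> lets a user bound the size of the quantities at \<open>s\<close> and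
  \<open>t\<close>, on which the price \<open>\<delta>\<close> depends.\<close>

lemma crossing_length:
  fixes g \<l> :: "real \<Rightarrow> real"
  assumes ab: "a \<le> b" and g: "continuous_on {a..b} g"
    and mono: "\<And>s t. a \<le> s \<Longrightarrow> s \<le> t \<Longrightarrow> t \<le> b \<Longrightarrow> \<l> s \<le> \<l> t"
    and \<delta>: "0 \<le> \<delta>"
    and jump: "\<And>s t k. a \<le> s \<Longrightarrow> s < t \<Longrightarrow> t \<le> b \<Longrightarrow>
       {g s, g t} = {of_int k, of_int (k + 1)} \<Longrightarrow> {g s, g t} \<subseteq> {min (g a) (g b)..max (g a) (g b)}
       \<Longrightarrow> \<delta> \<le> \<l> t - \<l> s"
  shows "(\<bar>g b - g a\<bar> - 2) * \<delta> \<le> \<l> b - \<l> a"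
proof (cases "g a \<le> g b")
  case True
  have "(g b - g a - 2) * \<delta> \<le> \<l> b - \<l> a"
    using ab g mono \<delta> True
  proof (rule crossing_length_increasing)
    fix s t k assume "a \<le> s" "s < t" "t \<le> b" "g a \<le> of_int k" "of_int (k + 1) \<le> g b"
      "g s = of_int k" "g t = of_int (k + 1)"
    then show "\<delta> \<le> \<l> t - \<l> s" using True by (intro jump[of s t k]) auto
  qed
  then show ?thesis using True by simp
next
  case False
  have "((- g b) - (- g a) - 2) * \<delta> \<le> \<l> b - \<l> a"
    using ab continuous_on_minus[OF g] mono \<delta>
  proof (rule crossing_length_increasing)
    fix s t k assume st: "a \<le> s" "s < t" "t \<le> b" "- g a \<le> of_int k" "of_int (k + 1) \<le> - g b"
      "- g s = of_int k" "- g t = of_int (k + 1)"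
    \<comment> \<open>Under negation the upper level \<open>k + 1\<close> becomes the lower level
      \<open>- k - 1\<close>.\<close>
    then have "g s = of_int (- k - 1 + 1)" "g t = of_int (- k - 1)" by auto
    then show "\<delta> \<le> \<l> t - \<l> s" using st False by (intro jump[of s t "- k - 1"]) auto
  qed (use False in auto)
  then show ?thesis using False by simp
qed

text \<open>\<open>d\<close> is the first time at which \<open>r\<close> reaches
  \<open>\<beta>\<close>, and \<open>c\<close> is the last time up to \<open>d\<close> at which
  \<open>r\<close> is at most \<open>\<alpha>\<close>.\<close>

lemma crossing_subinterval:
  fixes r :: "real \<Rightarrow> real"
  assumes ab: "a \<le> b" and r: "continuous_on {a..b} r"
    and \<alpha>: "r a \<le> \<alpha>" and \<beta>: "\<beta> \<le> r b" and "\<alpha> \<le> \<beta>"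
  obtains c d where "a \<le> c" "c \<le> d" "d \<le> b" "r c = \<alpha>" "r d = \<beta>"
    "\<And>t. c \<le> t \<Longrightarrow> t \<le> d \<Longrightarrow> r t \<in> {\<alpha>..\<beta>}"
proof -
  obtain d where d: "a \<le> d" "d \<le> b" "\<beta> \<le> r d" and d_min: "\<And>t. a \<le> t \<Longrightarrow> t \<le> b \<Longrightarrow> \<beta> \<le> r t \<Longrightarrow> d \<le> t"
  proof -
    have "closed ({a..b} \<inter> r -` {\<beta>..})" by (intro continuous_closed_preimage r) auto
    then have "compact ({a..b} \<inter> ({a..b} \<inter> r -` {\<beta>..}))" by (intro compact_Int_closed) auto
    moreover have "b \<in> {a..b} \<inter> ({a..b} \<inter> r -` {\<beta>..})" using ab \<beta> by auto
    ultimately obtain d where "d \<in> {a..b} \<inter> ({a..b} \<inter> r -` {\<beta>..})"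
      "\<forall>t\<in>{a..b} \<inter> ({a..b} \<inter> r -` {\<beta>..}). d \<le> t"
      using compact_attains_inf by (metis empty_iff)
    then show thesis by (intro that[of d]) auto
  qed
  obtain c where c: "a \<le> c" "c \<le> d" "r c \<le> \<alpha>" and c_max: "\<And>t. a \<le> t \<Longrightarrow> t \<le> d \<Longrightarrow> r t \<le> \<alpha> \<Longrightarrow> t \<le> c"
  proof -
    have "closed ({a..d} \<inter> r -` {..\<alpha>})"
      using d by (intro continuous_closed_preimage continuous_on_subset[OF r]) auto
    then have "compact ({a..d} \<inter> ({a..d} \<inter> r -` {..\<alpha>}))" by (intro compact_Int_closed) auto
    moreover have "a \<in> {a..d} \<inter> ({a..d} \<inter> r -` {..\<alpha>})" using d \<alpha> by auto
    ultimately obtain c where "c \<in> {a..d} \<inter> ({a..d} \<inter> r -` {..\<alpha>})"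
      "\<forall>t\<in>{a..d} \<inter> ({a..d} \<inter> r -` {..\<alpha>}). t \<le> c"
      using compact_attains_sup by (metis empty_iff)
    then show thesis by (intro that[of c]) auto
  qed
  have cont: "continuous_on {c..d} r" using c d by (intro continuous_on_subset[OF r]) auto
  obtain t where t: "c \<le> t" "t \<le> d" "r t = \<beta>"
    using IVT'[of r c \<beta> d] c d cont \<open>\<alpha> \<le> \<beta>\<close> by auto
  then have rd: "r d = \<beta>" using d_min[of t] c d by (cases "t = d") auto
  obtain u where u: "c \<le> u" "u \<le> d" "r u = \<alpha>"
    using IVT'[of r c \<alpha> d] c d cont \<open>\<alpha> \<le> \<beta>\<close> by auto
  then have rc: "r c = \<alpha>" using c_max[of u] c by (cases "u = c") auto
  show thesis
  proof (rule that[of c d])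
    fix t assume t: "c \<le> t" "t \<le> d"
    have "\<alpha> \<le> r t" using c_max[of t] t c rc by (cases "t = c") force+
    moreover have "r t \<le> \<beta>" using d_min[of t] t c d rd by (cases "t = d") force+
    ultimately show "r t \<in> {\<alpha>..\<beta>}" by simp
  qed (use c d rc rd in auto)
qed

text \<open>The factor 1/64 keeps the shift inside the margins around the corrugated zone. The phase
  is counted in half turns, so extremes occur when \<open>1000 / u\<close> is an integer; from u
  down to u/2 there are about \<open>1000 / u\<close> of them, each worth at least about u/64, and
  the total variation is bounded below independently of u.\<close>

definition wiggle :: "real \<Rightarrow> real" where
  "wiggle u = u / 64 * cos (pi * (1000 / u))"

text \<open>A trapezoid: 1 on \<open>[1/4, 1/2]\<close>, 0 outside \<open>(1/8, 5/8)\<close>, and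
  linear in between.\<close>

definition cutoff :: "real \<Rightarrow> real" where
  "cutoff r = max 0 (min 1 (min (8 * r - 1) (5 - 8 * r)))"

text \<open>The amplitude \<open>2 * u\<close> is twice the greatest possible deviation u of a point
  of the sheared pyramid from the sheet, so opposite crests are separated. The \<open>max\<close>
  keeps the denominator positive and changes it only where \<open>cutoff\<close> vanishes. At
  \<open>u = 0\<close> the leading factor gives the value 0.\<close>

definition fold_height :: "real \<Rightarrow> real \<Rightarrow> real" where
  "fold_height x u = 2 * u * cutoff ((x - wiggle u) / u) * cos (pi * (256 / max (x - wiggle u) (u / 8)))"

lemma abs_wiggle_le: "u \<ge> 0 \<Longrightarrow> \<bar>wiggle u\<bar> \<le> u / 64"
  by (simp add: wiggle_def abs_mult mult_left_le)

lemma cutoff_bounds: "0 \<le> cutoff r" "cutoff r \<le> 1"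
  by (auto simp: cutoff_def)

lemma cutoff_eq_0: "r \<le> 1 / 8 \<or> 5 / 8 \<le> r \<Longrightarrow> cutoff r = 0"
  by (auto simp: cutoff_def)

lemma abs_fold_height_le: "u \<ge> 0 \<Longrightarrow> \<bar>fold_height x u\<bar> \<le> 2 * u"
proof -
  assume u: "u \<ge> 0"
  have "\<bar>fold_height x u\<bar> = (2 * u) * (cutoff ((x - wiggle u) / u) * \<bar>cos (pi * (256 / max (x - wiggle u) (u / 8)))\<bar>)"
    using u cutoff_bounds by (simp add: fold_height_def abs_mult)
  also have "\<dots> \<le> (2 * u) * (1 * 1)"
    using u cutoff_bounds by (intro mult_left_mono mult_mono) auto
  finally show ?thesis by simp
qed

text \<open>The margins absorb the wiggle: 1/16 + 1/64 is at most 1/8, and 3/4 - 1/64 is at least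
  5/8.\<close>

lemma fold_height_eq_0:
  assumes "u > 0" "x \<le> u / 16 \<or> 3 / 4 * u \<le> x"
  shows "fold_height x u = 0"
proof -
  have "x - wiggle u \<le> u / 8 \<or> 5 / 8 * u \<le> x - wiggle u"
    using assms abs_wiggle_le[of u] by (auto simp: abs_le_iff)
  then have "(x - wiggle u) / u \<le> 1 / 8 \<or> 5 / 8 \<le> (x - wiggle u) / u"
    using assms by (auto simp: field_simps)
  then have "cutoff ((x - wiggle u) / u) = 0" by (rule cutoff_eq_0)
  then show ?thesis by (simp add: fold_height_def)
qed

text \<open>
  On the crossing, either \<open>V = X - wiggle U\<close> changes by a factor \<open>65 / 64\<close>, and then the many
  oscillations of \<open>fold_height\<close> force \<open>Z\<close> to move, or \<open>U\<close> drops to about one half, and then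
  the oscillations of \<open>wiggle\<close> force \<open>X\<close> to move.
\<close>

lemma fold_crossing_length:
  fixes X U Z \<l> :: "real \<Rightarrow> real"
  assumes X: "continuous_on {0..1} X" and U: "continuous_on {0..1} U"
    and U01: "\<And>t. 0 \<le> t \<Longrightarrow> t \<le> 1 \<Longrightarrow> 0 < U t \<and> U t \<le> 1"
    and Z: "\<And>t. 0 \<le> t \<Longrightarrow> t \<le> 1 \<Longrightarrow> \<bar>Z t - fold_height (X t) (U t)\<bar> \<le> U t"
    and lX: "\<And>s t. 0 \<le> s \<Longrightarrow> s \<le> t \<Longrightarrow> t \<le> 1 \<Longrightarrow> \<bar>X t - X s\<bar> \<le> \<l> t - \<l> s"
    and lZ: "\<And>s t. 0 \<le> s \<Longrightarrow> s \<le> t \<Longrightarrow> t \<le> 1 \<Longrightarrow> \<bar>Z t - Z s\<bar> \<le> \<l> t - \<l> s"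
    and start: "X 0 \<le> U 0 / 8" and final: "3 / 4 * U 1 \<le> X 1"
  shows "4 \<le> \<l> 1 - \<l> 0"
proof (rule ccontr)
  assume "\<not> 4 \<le> \<l> 1 - \<l> 0"
  then have short: "\<l> 1 - \<l> 0 < 4" by simp
  have mono: "\<l> s \<le> \<l> t" if "0 \<le> s" "s \<le> t" "t \<le> 1" for s t
    using lX[OF that] by linarith
  define V where "V = (\<lambda>t. X t - wiggle (U t))"
  have Une: "U t \<noteq> 0" if "t \<in> {0..1}" for t using U01[of t] that by simp
  have V: "continuous_on {0..1} V" unfolding V_def wiggle_def
    using X U Une by (intro continuous_intros) auto
  have r: "continuous_on {0..1} (\<lambda>t. V t / U t)" using V U Une by (intro continuous_intros) auto
  have "V 0 / U 0 \<le> 1 / 4"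
    using start U01[of 0] abs_wiggle_le[of "U 0"] by (simp add: V_def field_simps abs_le_iff)
  moreover have "1 / 2 \<le> V 1 / U 1"
    using final U01[of 1] abs_wiggle_le[of "U 1"] by (simp add: V_def field_simps abs_le_iff)
  \<comment> \<open>On this part of the path \<open>cutoff\<close> is constantly 1, so the height is
    a pure oscillation of amplitude \<open>2 * U t\<close>.\<close>
  ultimately obtain a b where ab: "0 \<le> a" "a \<le> b" "b \<le> 1" and ra: "V a / U a = 1 / 4" and rb: "V b / U b = 1 / 2"
    and rab: "\<And>t. a \<le> t \<Longrightarrow> t \<le> b \<Longrightarrow> V t / U t \<in> {1/4..1/2}"
    using crossing_subinterval[OF _ r, of "1/4" "1/2"] by auto
  have U_pos: "0 < U t" "U t \<le> 1" if "a \<le> t" "t \<le> b" for t using U01[of t] that ab by auto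
  have VU: "U t \<le> 4 * V t" "2 * V t \<le> U t" "0 < V t" if "a \<le> t" "t \<le> b" for t
  proof -
    show "U t \<le> 4 * V t" "2 * V t \<le> U t"
      using rab[OF that] U_pos[OF that] by (auto simp: field_simps)
    with U_pos[OF that] show "0 < V t" by linarith
  qed
  have Ua: "U a = 4 * V a" and Ub: "U b = 2 * V b"
    using ra rb U_pos[of a] U_pos[of b] ab by (auto simp: field_simps)
  have cos_pi: "\<bar>cos (pi * x)\<bar> = 1" "cos (pi * y) = - cos (pi * x)"
    if "{x, y} = {real_of_int k, of_int (k + 1)}" for x y k
  proof -
    have "x = of_int k \<and> y = of_int (k + 1) \<or> y = of_int k \<and> x = of_int (k + 1)"
      using that by (auto simp: doubleton_eq_iff)
    then show "\<bar>cos (pi * x)\<bar> = 1" "cos (pi * y) = - cos (pi * x)"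
      by (auto simp: cos_npi_int simp del: of_int_add)
  qed
  have part: "\<l> t - \<l> s < 4" if "a \<le> s" "s \<le> t" "t \<le> b" for s t
    using mono[of 0 s] mono[of t 1] short that ab by linarith
  have fold: "fold_height (X t) (U t) = 2 * U t * cos (pi * (256 / V t))" if t: "a \<le> t" "t \<le> b" for t
  proof -
    have "cutoff (V t / U t) = 1" using rab[OF t] by (auto simp: cutoff_def)
    moreover have "max (V t) (U t / 8) = V t" using VU[OF t] by simp
    ultimately show ?thesis by (simp add: fold_height_def V_def)
  qed
  \<comment> \<open>A change of \<open>V\<close> by the factor 65/64 would already cost more than
    the whole path has to spend.\<close>
  have V_ratio: "max (V c) (V d) < 65 / 64 * min (V c) (V d)" if cd: "a \<le> c" "c \<le> d" "d \<le> b" for c d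
  proof (rule ccontr)
    assume contra: "\<not> ?thesis"
    define w where "w = min (V c) (V d)"
    define w' where "w' = max (V c) (V d)"
    have ww: "65 / 64 * w \<le> w'" using contra by (simp add: w_def w'_def)
    have w0: "0 < w" "w \<le> 1 / 2"
      using VU[of c] VU[of d] U_pos[of c] cd by (auto simp: w_def min_le_iff_disj)
    have Vne: "V t \<noteq> 0" if "t \<in> {c..d}" for t using VU(3)[of t] that cd by auto
    have "(\<bar>256 / V d - 256 / V c\<bar> - 2) * (4 * w) \<le> \<l> d - \<l> c"
    proof (rule crossing_length)
      show "continuous_on {c..d} (\<lambda>t. 256 / V t)"
      proof (intro continuous_intros)
        show "continuous_on {c..d} V" using cd ab by (intro continuous_on_subset[OF V]) auto
      qed (use Vne in auto)
    next
      fix s t k assume st: "c \<le> s" "s < t" "t \<le> d"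
        and k: "{256 / V s, 256 / V t} = {real_of_int k, real_of_int (k + 1)}"
        and bnd: "{256 / V s, 256 / V t} \<subseteq> {min (256 / V c) (256 / V d)..max (256 / V c) (256 / V d)}"
      have st': "a \<le> s" "s \<le> b" "a \<le> t" "t \<le> b" "s \<le> t" using st cd by auto
      have "max (256 / V c) (256 / V d) \<le> 256 / w"
        using VU[of c] VU[of d] cd by (auto simp: w_def intro!: divide_left_mono)
      then have "256 / V s \<le> 256 / w" "256 / V t \<le> 256 / w" using bnd by auto
      then have w: "w \<le> V s" "w \<le> V t" using w0 VU(3)[OF st'(1,2)] VU(3)[OF st'(3,4)]
        by (auto simp: field_simps)
      define C where "C = cos (pi * (256 / V s))"
      have C: "\<bar>C\<bar> = 1" "cos (pi * (256 / V t)) = - C"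
        unfolding C_def using cos_pi[OF k] by auto
      have "fold_height (X s) (U s) = 2 * U s * C" "fold_height (X t) (U t) = 2 * U t * - C"
        unfolding fold[OF st'(1,2)] fold[OF st'(3,4)] C(2) by (simp_all add: C_def)
      moreover have "C = 1 \<or> C = -1" using C(1) by linarith
      moreover have "\<bar>Z s - fold_height (X s) (U s)\<bar> \<le> U s" "\<bar>Z t - fold_height (X t) (U t)\<bar> \<le> U t"
        using Z st' ab by auto
      \<comment> \<open>The crests at \<open>s\<close> and \<open>t\<close> have opposite signs and
        heights \<open>2 * U s\<close> and \<open>2 * U t\<close>, while \<open>Z\<close> may
        deviate from them by only \<open>U s\<close> and \<open>U t\<close>. Since \<open>U\<close>
        is at least \<open>2 * V\<close>, the step costs at least \<open>4 * w\<close>.\<close>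
      ultimately have "U s + U t \<le> \<bar>Z t - Z s\<bar>" by (elim disjE) auto
      also have "\<dots> \<le> \<l> t - \<l> s" using lZ[of s t] st' ab by auto
      finally show "4 * w \<le> \<l> t - \<l> s" using w VU(2)[OF st'(1,2)] VU(2)[OF st'(3,4)] by linarith
    qed (use cd ab mono w0 in auto)
    moreover have "\<bar>256 / V d - 256 / V c\<bar> = 256 / w - 256 / w'"
      using VU(3)[of c] VU(3)[of d] cd
      by (cases "V c \<le> V d") (auto simp: w_def w'_def min_def max_def abs_if field_simps)
    moreover have "256 / w' \<le> 256 / (65 / 64 * w)"
      using ww w0 by (intro divide_left_mono mult_pos_pos) auto
    then have "(256 / w - 256 / (65 / 64 * w) - 2) * (4 * w) \<le> (256 / w - 256 / w' - 2) * (4 * w)"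
      using w0 by (intro mult_right_mono) auto
    \<comment> \<open>As \<open>w \<le> 1 / 2\<close>, this exceeds 11, against a total length below
      4.\<close>
    moreover have "(256 / w - 256 / (65 / 64 * w) - 2) * (4 * w) = 1024 / 65 - 8 * w"
      using w0 by (simp add: field_simps)
    ultimately show False using part[OF cd] w0 by simp
  qed
  have V_ab: "V b < 65 / 64 * V a" "V a < 65 / 64 * V b"
    using V_ratio[of a b] ab VU(3)[of a] VU(3)[of b] by (auto simp: max_def min_def split: if_splits)
  \<comment> \<open>\<open>V / U\<close> doubles from \<open>a\<close> to \<open>b\<close> although
    \<open>V\<close> is nearly constant; so \<open>U\<close> is nearly halved.\<close>
  have Ub_less: "U b \<le> 65 / 128 * U a" and Ub_ge: "32 / 65 * U a \<le> U b" using V_ab Ua Ub by auto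
  define u where "u = U a"
  have u: "0 < u" "u \<le> 1" using U_pos[of a] ab by (auto simp: u_def)
  have Une': "U t \<noteq> 0" if "t \<in> {a..b}" for t using U_pos(1)[of t] that by auto
  have "(\<bar>1000 / U b - 1000 / U a\<bar> - 2) * (u / 100) \<le> \<l> b - \<l> a"
  proof (rule crossing_length)
    show "continuous_on {a..b} (\<lambda>t. 1000 / U t)"
    proof (intro continuous_intros)
      show "continuous_on {a..b} U" using ab by (intro continuous_on_subset[OF U]) auto
    qed (use Une' in auto)
  next
    fix s t k assume st: "a \<le> s" "s < t" "t \<le> b"
      and k: "{1000 / U s, 1000 / U t} = {real_of_int k, real_of_int (k + 1)}"
      and bnd: "{1000 / U s, 1000 / U t} \<subseteq> {min (1000 / U a) (1000 / U b)..max (1000 / U a) (1000 / U b)}"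
    have st': "a \<le> s" "s \<le> b" "a \<le> t" "t \<le> b" "s \<le> t" using st by auto
    have "max (1000 / U a) (1000 / U b) = 1000 / U b"
      using Ub_less U_pos[of a] U_pos[of b] ab by (auto simp: max_def field_simps)
    then have "1000 / U s \<le> 1000 / U b" "1000 / U t \<le> 1000 / U b" using bnd by auto
    then have Ust: "U b \<le> U s" "U b \<le> U t"
      using U_pos[of b] U_pos[of s] U_pos[of t] ab st' by (auto simp: field_simps)
    define C where "C = cos (pi * (1000 / U s))"
    have C: "\<bar>C\<bar> = 1" "cos (pi * (1000 / U t)) = - C"
      unfolding C_def using cos_pi[OF k] by auto
    have "wiggle (U s) = U s / 64 * C" "wiggle (U t) = U t / 64 * - C"
      unfolding wiggle_def C(2) by (simp_all add: C_def)
    moreover have "C = 1 \<or> C = -1" using C(1) by linarith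
    ultimately have "\<bar>wiggle (U t) - wiggle (U s)\<bar> = U s / 64 + U t / 64"
      using U_pos[of s] U_pos[of t] st' by (elim disjE) auto
    moreover have "\<bar>wiggle (U t) - wiggle (U s)\<bar> \<le> \<bar>X t - X s\<bar> + \<bar>V t - V s\<bar>"
      unfolding V_def by linarith
    moreover have "\<bar>V t - V s\<bar> \<le> V t / 64"
      using V_ratio[of s t] st' VU(3)[of s] VU(3)[of t] by (auto simp: max_def min_def split: if_splits)
    \<comment> \<open>The wiggle changes by \<open>(U s + U t) / 64\<close>, and \<open>V\<close>
      takes over at most \<open>U t / 128\<close> of it. What is left for \<open>X\<close> is at
      least 3/128 of \<open>U b\<close>, and 3/128 times 32/65 is greater than 1/100.\<close>
    ultimately have "u / 100 \<le> \<bar>X t - X s\<bar>"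
      using Ust Ub_ge VU(2)[OF st'(3,4)] u unfolding u_def by linarith
    also have "\<dots> \<le> \<l> t - \<l> s" using lX[of s t] st' ab by auto
    finally show "u / 100 \<le> \<l> t - \<l> s" .
  qed (use ab mono u in auto)
  moreover have "1000 / (65 / 128 * u) \<le> 1000 / U b"
    using Ub_less u U_pos[of b] ab by (intro divide_left_mono mult_pos_pos) (auto simp: u_def)
  then have "(1000 / (65 / 128 * u) - 1000 / u - 2) * (u / 100) \<le> (\<bar>1000 / U b - 1000 / U a\<bar> - 2) * (u / 100)"
    using u by (intro mult_right_mono) (auto simp: u_def)
  \<comment> \<open>This exceeds 9, again too much for a length below 4.\<close>
  moreover have "(1000 / (65 / 128 * u) - 1000 / u - 2) * (u / 100) = 630 / 65 - u / 50"
    using u by (simp add: field_simps)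
  ultimately show False using part[OF order_refl ab(2) order_refl] u by linarith
qed

section \<open>The corrugated pyramid\<close>

definition lipschitzian_on :: "real set \<Rightarrow> (real \<Rightarrow> real) \<Rightarrow> bool" where
  "lipschitzian_on S f \<longleftrightarrow> (\<exists>L. L-lipschitz_on S f)"

lemma lipschitzian_onI:
  assumes "\<And>x y. x \<in> S \<Longrightarrow> y \<in> S \<Longrightarrow> \<bar>f x - f y\<bar> \<le> L * \<bar>x - y\<bar>"
  shows "lipschitzian_on S f"
proof -
  have "\<bar>L\<bar>-lipschitz_on S f"
  proof (rule lipschitz_onI)
    fix x y assume "x \<in> S" "y \<in> S"
    from assms[OF this] show "dist (f x) (f y) \<le> \<bar>L\<bar> * dist x y"
      using mult_right_mono[OF abs_ge_self[of L], of "\<bar>x - y\<bar>"] by (simp add: dist_real_def)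
  qed simp
  then show ?thesis by (auto simp: lipschitzian_on_def)
qed

lemma lipschitzian_onE:
  assumes "lipschitzian_on S f"
  obtains L where "0 \<le> L" "\<And>x y. x \<in> S \<Longrightarrow> y \<in> S \<Longrightarrow> \<bar>f x - f y\<bar> \<le> L * \<bar>x - y\<bar>"
  using assms by (auto simp: lipschitzian_on_def lipschitz_on_def dist_real_def)

lemma lipschitzian_on_bounded:
  assumes "lipschitzian_on S f" "compact S"
  obtains B where "0 \<le> B" "\<And>x. x \<in> S \<Longrightarrow> \<bar>f x\<bar> \<le> B"
proof -
  have "continuous_on S f" using assms by (auto simp: lipschitzian_on_def dest: lipschitz_on_continuous_on)
  then have "bounded (f ` S)" using assms by (simp add: compact_continuous_image compact_imp_bounded)
  then obtain B where B: "B > 0" "\<And>x. x \<in> S \<Longrightarrow> norm (f x) \<le> B" by (auto simp: bounded_pos)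
  show thesis by (rule that[of B]) (use B in auto)
qed

lemma lipschitzian_on_affine: "lipschitzian_on S (\<lambda>x. a + b * x)"
  by (rule lipschitzian_onI[of _ _ "\<bar>b\<bar>"]) (simp add: abs_mult flip: right_diff_distrib)

lemma lipschitzian_on_add:
  assumes "lipschitzian_on S f" "lipschitzian_on S g"
  shows "lipschitzian_on S (\<lambda>x. f x + g x)"
  using assms unfolding lipschitzian_on_def by (blast intro: lipschitz_on_add)

lemma lipschitzian_on_mult:
  assumes f: "lipschitzian_on S f" and g: "lipschitzian_on S g" and S: "compact S"
  shows "lipschitzian_on S (\<lambda>x. f x * g x)"
proof -
  obtain L where L: "0 \<le> L" "\<And>x y. x \<in> S \<Longrightarrow> y \<in> S \<Longrightarrow> \<bar>f x - f y\<bar> \<le> L * \<bar>x - y\<bar>"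
    using f by (rule lipschitzian_onE) blast
  obtain M where M: "0 \<le> M" "\<And>x y. x \<in> S \<Longrightarrow> y \<in> S \<Longrightarrow> \<bar>g x - g y\<bar> \<le> M * \<bar>x - y\<bar>"
    using g by (rule lipschitzian_onE) blast
  obtain A where A: "0 \<le> A" "\<And>x. x \<in> S \<Longrightarrow> \<bar>f x\<bar> \<le> A" using f S by (rule lipschitzian_on_bounded) blast
  obtain B where B: "0 \<le> B" "\<And>x. x \<in> S \<Longrightarrow> \<bar>g x\<bar> \<le> B" using g S by (rule lipschitzian_on_bounded) blast
  show ?thesis
  proof (rule lipschitzian_onI)
    fix x y assume xy: "x \<in> S" "y \<in> S"
    have "f x * g x - f y * g y = f x * (g x - g y) + (f x - f y) * g y" by (simp add: algebra_simps)
    then have "\<bar>f x * g x - f y * g y\<bar> \<le> \<bar>f x\<bar> * \<bar>g x - g y\<bar> + \<bar>f x - f y\<bar> * \<bar>g y\<bar>"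
      by (metis abs_mult abs_triangle_ineq)
    also have "\<dots> \<le> A * (M * \<bar>x - y\<bar>) + (L * \<bar>x - y\<bar>) * B"
      using A(2)[OF xy(1)] B(2)[OF xy(2)] L(2)[OF xy] M(2)[OF xy] A(1) B(1) L(1) M(1)
      by (intro add_mono mult_mono mult_nonneg_nonneg) auto
    finally show "\<bar>f x * g x - f y * g y\<bar> \<le> (A * M + L * B) * \<bar>x - y\<bar>" by (simp add: algebra_simps)
  qed
qed

lemma lipschitzian_on_const: "lipschitzian_on S (\<lambda>x. c)"
  using lipschitzian_on_affine[of S c 0] by simp

lemma lipschitzian_on_diff:
  assumes "lipschitzian_on S f" "lipschitzian_on S g"
  shows "lipschitzian_on S (\<lambda>x. f x - g x)"
  using assms unfolding lipschitzian_on_def by (blast intro: lipschitz_on_diff)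

lemma lipschitzian_on_divide:
  assumes f: "lipschitzian_on S f" and g: "lipschitzian_on S g" and S: "compact S"
    and e: "e > 0" "\<And>x. x \<in> S \<Longrightarrow> e \<le> g x"
  shows "lipschitzian_on S (\<lambda>x. f x / g x)"
proof -
  obtain L where L: "0 \<le> L" "\<And>x y. x \<in> S \<Longrightarrow> y \<in> S \<Longrightarrow> \<bar>g x - g y\<bar> \<le> L * \<bar>x - y\<bar>"
    using g by (rule lipschitzian_onE) blast
  have "lipschitzian_on S (\<lambda>x. 1 / g x)"
  proof (rule lipschitzian_onI)
    fix x y assume xy: "x \<in> S" "y \<in> S"
    have gp: "e \<le> g x" "e \<le> g y" using e xy by auto
    then have "1 / g x - 1 / g y = (g y - g x) / (g x * g y)" using e(1) by (simp add: field_simps)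
    then have "\<bar>1 / g x - 1 / g y\<bar> = \<bar>g x - g y\<bar> / (g x * g y)"
      using gp e(1) by (simp add: abs_mult abs_minus_commute)
    also have "\<dots> \<le> (L * \<bar>x - y\<bar>) / (e * e)"
      using gp e(1) L xy by (intro frac_le mult_mono) auto
    finally show "\<bar>1 / g x - 1 / g y\<bar> \<le> (L / (e * e)) * \<bar>x - y\<bar>" by simp
  qed
  from lipschitzian_on_mult[OF f this S] show ?thesis by simp
qed

lemma lipschitzian_on_nonexpansive:
  assumes f: "lipschitzian_on S f" and h: "\<And>a b. \<bar>h a - h b\<bar> \<le> \<bar>a - b\<bar>"
  shows "lipschitzian_on S (\<lambda>x. h (f x))"
proof -
  obtain L where "\<And>x y. x \<in> S \<Longrightarrow> y \<in> S \<Longrightarrow> \<bar>f x - f y\<bar> \<le> L * \<bar>x - y\<bar>"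
    using f by (rule lipschitzian_onE) blast
  then show ?thesis by (intro lipschitzian_onI[of _ _ L]) (use h order_trans in blast)
qed

lemma lipschitzian_on_cmult: "lipschitzian_on S f \<Longrightarrow> lipschitzian_on S (\<lambda>x. c * f x)"
  unfolding lipschitzian_on_def by (metis lipschitz_on_cmult_real)

lemma lipschitzian_on_abs: "lipschitzian_on S f \<Longrightarrow> lipschitzian_on S (\<lambda>x. \<bar>f x\<bar>)"
  by (erule lipschitzian_on_nonexpansive) simp

lemma abs_cos_diff_le: "\<bar>cos a - cos b\<bar> \<le> \<bar>a - b\<bar>" for a b :: real
proof -
  have "norm (cos a - cos b) \<le> 1 * norm (a - b)"
    by (rule field_differentiable_bound[of UNIV cos "\<lambda>x. - sin x"])
      (auto intro!: derivative_eq_intros)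
  then show ?thesis by simp
qed

lemma lipschitzian_on_cos: "lipschitzian_on S f \<Longrightarrow> lipschitzian_on S (\<lambda>x. cos (f x))"
  by (erule lipschitzian_on_nonexpansive) (rule abs_cos_diff_le)

lemma lipschitzian_on_max:
  assumes "lipschitzian_on S f" "lipschitzian_on S g"
  shows "lipschitzian_on S (\<lambda>x. max (f x) (g x))"
proof -
  have eq: "(\<lambda>x. max (f x) (g x)) = (\<lambda>x. (1/2) * (f x + g x + \<bar>f x - g x\<bar>))"
    by (auto simp: max_def fun_eq_iff)
  show ?thesis unfolding eq
    by (intro lipschitzian_on_cmult lipschitzian_on_add lipschitzian_on_abs lipschitzian_on_diff assms)
qed

lemma lipschitzian_on_cutoff:
  assumes "lipschitzian_on S f"
  shows "lipschitzian_on S (\<lambda>x. cutoff (f x))"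
proof -
  \<comment> \<open>The minima are written as \<open>1 - max 0 (max (1 - a) (1 - b))\<close>, so
    that the rule for \<open>max\<close> suffices.\<close>
  have "lipschitzian_on S (\<lambda>x. max 0 (1 - max 0 (max (2 - 8 * f x) (8 * f x - 4))))"
    if "lipschitzian_on S (\<lambda>x. 8 * f x)"
    by (intro lipschitzian_on_max lipschitzian_on_diff lipschitzian_on_const that)
  moreover have "lipschitzian_on S (\<lambda>x. 8 * f x)" using assms by (rule lipschitzian_on_cmult)
  moreover have "max 0 (1 - max 0 (max (2 - 8 * r) (8 * r - 4))) = cutoff r" for r
    by (auto simp: cutoff_def max_def min_def)
  ultimately show ?thesis by simp
qed

text \<open>The slopes of the folds grow without bound as u tends to 0; the bound \<open>e\<close>
  keeps every denominator away from 0.\<close>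

lemma lipschitzian_on_fold_height:
  assumes X: "lipschitzian_on S X" and U: "lipschitzian_on S U" and S: "compact S"
    and e: "e > 0" "\<And>t. t \<in> S \<Longrightarrow> e \<le> U t"
  shows "lipschitzian_on S (\<lambda>t. fold_height (X t) (U t))"
proof -
  note c = lipschitzian_on_const
  have w: "lipschitzian_on S (\<lambda>t. wiggle (U t))"
    unfolding wiggle_def
    by (intro lipschitzian_on_mult[OF _ _ S] lipschitzian_on_cos lipschitzian_on_divide[OF c U S e]
      lipschitzian_on_divide[OF U c S, of 64] c) auto
  have v: "lipschitzian_on S (\<lambda>t. X t - wiggle (U t))" by (rule lipschitzian_on_diff[OF X w])
  have u8: "lipschitzian_on S (\<lambda>t. U t / 8)" by (rule lipschitzian_on_divide[OF U c S, of 8]) auto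
  have m: "e / 8 \<le> max (X t - wiggle (U t)) (U t / 8)" if "t \<in> S" for t 
    using e(2)[OF that] max.cobounded2[of "U t / 8" "X t - wiggle (U t)"] by linarith
  show ?thesis unfolding fold_height_def
    using e(1) by (intro lipschitzian_on_mult[OF _ _ S] lipschitzian_on_cos lipschitzian_on_cutoff
      lipschitzian_on_divide[OF v U S e] lipschitzian_on_divide[OF c lipschitzian_on_max[OF v u8] S _ m] c U) auto
qed

section \<open>The pyramid and its shear\<close>

definition pyramid :: "'n \<Rightarrow> (real ^ 'n) set" where
  "pyramid j = {p. p $ j \<le> 1 \<and> (\<forall>m. \<bar>p $ m\<bar> \<le> p $ j)}"

text \<open>In \<open>pyramid\<close> the case \<open>m = j\<close> of the bound encodes
  \<open>0 \<le> p $ j\<close>. With a strict bound that case would be false, so it is excluded here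
  and positivity is stated separately.\<close>

definition open_pyramid :: "'n \<Rightarrow> (real ^ 'n) set" where
  "open_pyramid j = {p. 0 < p $ j \<and> p $ j < 1 \<and> (\<forall>m. m \<noteq> j \<longrightarrow> \<bar>p $ m\<bar> < p $ j)}"

definition fold_map :: "'n \<Rightarrow> 'n \<Rightarrow> 'n \<Rightarrow> real ^ 'n \<Rightarrow> real ^ 'n" where
  "fold_map i j k p = p + fold_height (p $ i) (p $ j) *\<^sub>R axis k 1"

lemma pyramid_nonneg: "p \<in> pyramid j \<Longrightarrow> 0 \<le> p $ j"
  unfolding pyramid_def by (metis (mono_tags, lifting) abs_ge_zero mem_Collect_eq order_trans)

lemma pyramid_eq_0: "p \<in> pyramid j \<Longrightarrow> p $ j = 0 \<Longrightarrow> p = 0"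
  by (auto simp: pyramid_def vec_eq_iff)

lemma open_pyramid_subset: "open_pyramid j \<subseteq> pyramid j"
proof
  fix p assume p: "p \<in> open_pyramid j"
  have "\<bar>p $ m\<bar> \<le> p $ j" for m using p by (cases "m = j") (auto simp: open_pyramid_def less_imp_le)
  then show "p \<in> pyramid j" using p by (auto simp: pyramid_def open_pyramid_def)
qed

lemma open_open_pyramid: "open (open_pyramid j)"
proof -
  have "open_pyramid j = {p. 0 < p $ j} \<inter> {p. p $ j < 1} \<inter> (\<Inter>m\<in>-{j}. {p. \<bar>p $ m\<bar> < p $ j})"
    by (auto simp: open_pyramid_def)
  then show ?thesis
    by (simp add: open_Int open_INT open_Collect_less continuous_intros)
qed

lemma convex_pyramid:
  fixes j :: "'n::finite"
  shows "convex (pyramid j)"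
proof (rule convexI)
  fix x y :: "real ^ 'n" and a b :: real
  assume xy: "x \<in> pyramid j" "y \<in> pyramid j" and ab: "0 \<le> a" "0 \<le> b" "a + b = 1"
  have "\<bar>a * x $ m + b * y $ m\<bar> \<le> a * x $ j + b * y $ j" for m
  proof -
    have "\<bar>a * x $ m + b * y $ m\<bar> \<le> a * \<bar>x $ m\<bar> + b * \<bar>y $ m\<bar>"
      using abs_triangle_ineq[of "a * x $ m" "b * y $ m"] ab by (simp add: abs_mult)
    also have "\<dots> \<le> a * x $ j + b * y $ j"
      using xy ab by (intro add_mono mult_left_mono) (auto simp: pyramid_def)
    finally show ?thesis .
  qed
  moreover have "a * x $ j + b * y $ j \<le> 1"
    using xy ab by (intro convex_bound_le) (auto simp: pyramid_def)
  ultimately show "a *\<^sub>R x + b *\<^sub>R y \<in> pyramid j" by (simp add: pyramid_def)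
qed

lemma compact_pyramid: "compact (pyramid j)"
proof -
  have "pyramid j \<subseteq> cbox (\<chi> m. -1) (\<chi> m. 1)"
    by (auto simp: pyramid_def mem_box_cart abs_le_iff) (smt (verit))+
  then have "bounded (pyramid j)" using bounded_cbox bounded_subset by blast
  moreover have "pyramid j = {p. p $ j \<le> 1} \<inter> (\<Inter>m. {p. \<bar>p $ m\<bar> \<le> p $ j})" by (auto simp: pyramid_def)
  then have "closed (pyramid j)"
    by (simp add: closed_Int closed_INT closed_Collect_le continuous_intros)
  ultimately show ?thesis by (simp add: compact_eq_bounded_closed)
qed

lemma segment_in_open_pyramid:
  assumes p: "p \<in> pyramid j" and t: "0 < t" "t \<le> 1"
  shows "(1 - t) *\<^sub>R p + t *\<^sub>R axis j (1/2) \<in> open_pyramid j"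
proof -
  have "(1 - t) * p $ j \<le> (1 - t) * 1" "0 \<le> (1 - t) * p $ j"
    using p t pyramid_nonneg[OF p] by (intro mult_left_mono mult_nonneg_nonneg; simp add: pyramid_def)+
  moreover have "\<bar>(1 - t) * p $ m\<bar> \<le> (1 - t) * p $ j" for m
    using p t by (auto simp: abs_mult pyramid_def intro: mult_left_mono)
  then have "\<bar>(1 - t) * p $ m\<bar> < (1 - t) * p $ j + t / 2" for m
    using t(1) by (meson add_strict_increasing2 half_gt_zero le_less_trans less_add_same_cancel1)
  ultimately show ?thesis using t by (auto simp: open_pyramid_def axis_def)
qed

lemma fold_map_nth:
  "fold_map i j k p $ m = p $ m + (if m = k then fold_height (p $ i) (p $ j) else 0)"
  by (simp add: fold_map_def axis_def)

lemma fold_map_eq_self: "fold_height (p $ i) (p $ j) = 0 \<Longrightarrow> fold_map i j k p = p"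
  by (simp add: fold_map_def)

lemma inj_fold_map:
  assumes "i \<noteq> k" "j \<noteq> k"
  shows "inj (fold_map i j k)"
proof (rule injI)
  fix p q assume eq: "fold_map i j k p = fold_map i j k q"
  have nth: "fold_map i j k p $ m = fold_map i j k q $ m" for m using eq by simp
  have "p $ i = q $ i" "p $ j = q $ j" using nth[of i] nth[of j] assms by (auto simp: fold_map_nth)
  then show "p = q" using eq by (simp add: fold_map_def)
qed

text \<open>Only the apex is critical: the frequencies blow up there, but the amplitude
  \<open>2 * p $ j\<close> squeezes the height to 0.\<close>

lemma continuous_on_fold_map:
  fixes i j k :: "'n::finite"
  shows "continuous_on (pyramid j) (fold_map i j k)"
proof -
  let ?f = "\<lambda>p :: real ^ 'n. fold_height (p $ i) (p $ j)"
  have "continuous_on (pyramid j) ?f"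
    unfolding continuous_on_eq_continuous_within
  proof
    fix p :: "real ^ 'n" assume p: "p \<in> pyramid j"
    show "continuous (at p within pyramid j) ?f"
    proof (cases "p $ j = 0")
      case True
      have "((\<lambda>q. 2 * q $ j) \<longlongrightarrow> 2 * p $ j) (at p within pyramid j)" by (intro tendsto_intros)
      then have lim: "((\<lambda>q. 2 * q $ j) \<longlongrightarrow> 0) (at p within pyramid j)" using True by simp
      have "eventually (\<lambda>q. q \<in> pyramid j) (at p within pyramid j)" by (simp add: eventually_at_filter)
      then have "eventually (\<lambda>q. norm (?f q) \<le> 2 * q $ j) (at p within pyramid j)"
        by eventually_elim (use abs_fold_height_le pyramid_nonneg in auto)
      then have "(?f \<longlongrightarrow> 0) (at p within pyramid j)" using lim by (rule Lim_null_comparison)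
      moreover have "?f p = 0" using True by (simp add: fold_height_def)
      ultimately show ?thesis by (simp add: continuous_within)
    next
      case False
      have "continuous_on {q :: real ^ 'n. 0 < q $ j} ?f"
        unfolding fold_height_def wiggle_def cutoff_def
        by (intro continuous_intros) (auto simp: max_def)
      moreover have "open {q :: real ^ 'n. 0 < q $ j}" by (intro open_Collect_less continuous_intros)
      ultimately have "continuous (at p) ?f"
        using False pyramid_nonneg[OF p] by (simp add: continuous_on_eq_continuous_at)
      then show ?thesis by (rule continuous_at_imp_continuous_at_within)
    qed
  qed
  then show ?thesis unfolding fold_map_def by (intro continuous_intros)
qed

lemma open_fold_map_open_pyramid:
  assumes "i \<noteq> k" "j \<noteq> k"
  shows "open (fold_map i j k ` open_pyramid j)"
  using assms open_open_pyramid continuous_on_subset[OF continuous_on_fold_map open_pyramid_subset]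
  by (intro invariance_of_domain) (auto intro: inj_on_subset[OF inj_fold_map])

lemma C0_manifold_fold_map_pyramid:
  fixes i j k :: "'n::finite"
  assumes "i \<noteq> k" "j \<noteq> k"
  shows "C0_manifold_with_boundary (fold_map i j k ` pyramid j)"
proof (rule C0_manifold_with_boundary_homeomorphic_cball)
  have "pyramid j homeomorphic fold_map i j k ` pyramid j"
    unfolding homeomorphic_def
    using homeomorphism_compact[OF compact_pyramid continuous_on_fold_map refl]
      inj_on_subset[OF inj_fold_map[OF assms]] by blast
  moreover have "axis j (1/2) \<in> open_pyramid j"
    using segment_in_open_pyramid[of 0 j 1] by (simp add: pyramid_def)
  then have "interior (pyramid j) \<noteq> {}"
    using interior_maximal[OF open_pyramid_subset open_open_pyramid] by blast
  then have "pyramid j homeomorphic cball (0 :: real ^ 'n) 1"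
    by (intro homeomorphic_convex_compact_cball convex_pyramid compact_pyramid) auto
  ultimately show "fold_map i j k ` pyramid j homeomorphic cball (0 :: real ^ 'n) 1"
    by (meson homeomorphic_sym homeomorphic_trans)
qed

text \<open>From the apex the segment runs along the axis, where coordinate \<open>i\<close> is 0
  and the height vanishes. From any other point coordinate \<open>j\<close> stays at least
  \<open>min (p $ j) (1/2)\<close>, which is positive, so the folds met have bounded slope.\<close>

lemma fold_map_segment_lipschitz:
  fixes i j k :: "'n::finite"
  assumes p: "p \<in> pyramid j" and "i \<noteq> j"
  obtains L where "L-lipschitz_on {0..1} (\<lambda>t. fold_map i j k ((1 - t) *\<^sub>R p + t *\<^sub>R axis j (1/2)))"
proof -
  let ?c = "axis j (1/2) :: real ^ 'n"
  let ?s = "\<lambda>t. (1 - t) *\<^sub>R p + t *\<^sub>R ?c"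
  define h where "h = (\<lambda>t. fold_height (?s t $ i) (?s t $ j))"
  have s_j: "?s t $ j = (1 - t) * p $ j + t / 2" for t by (simp add: axis_def)
  have s_i: "?s t $ i = p $ i + (- (p $ i)) * t" for t using \<open>i \<noteq> j\<close> by (simp add: axis_def algebra_simps)
  have "lipschitzian_on {0..1} h"
  proof (cases "p $ j = 0")
    case True
    then have [simp]: "p = 0" using p by (rule pyramid_eq_0[rotated])
    have "h t = 0" if "t \<in> {0..1}" for t
    proof (cases "t = 0")
      case False
      then show ?thesis using that \<open>i \<noteq> j\<close> unfolding h_def by (intro fold_height_eq_0) (auto simp: axis_def)
    qed (simp add: h_def fold_height_def)
    then show ?thesis by (intro lipschitzian_onI[of _ _ 0]) simp
  next
    case False
    define e where "e = min (p $ j) (1/2)"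
    have e: "0 < e" using False pyramid_nonneg[OF p] by (simp add: e_def)
    have "e \<le> ?s t $ j" if t: "t \<in> {0..1}" for t
    proof -
      have "(1 - t) * e + t * e \<le> (1 - t) * p $ j + t * (1/2)"
        using t by (intro add_mono mult_left_mono) (auto simp: e_def)
      then show ?thesis unfolding s_j by (simp add: algebra_simps)
    qed
    moreover have "lipschitzian_on {0..1} (\<lambda>t. ?s t $ i)" unfolding s_i by (rule lipschitzian_on_affine)
    moreover have "?s t $ j = p $ j + (1/2 - p $ j) * t" for t unfolding s_j by (simp add: algebra_simps)
    then have "lipschitzian_on {0..1} (\<lambda>t. ?s t $ j)" using lipschitzian_on_affine by presburger
    ultimately show ?thesis unfolding h_def using e by (intro lipschitzian_on_fold_height) auto
  qed
  then obtain L where L: "0 \<le> L" "\<And>x y. x \<in> {0..1} \<Longrightarrow> y \<in> {0..1} \<Longrightarrow> \<bar>h x - h y\<bar> \<le> L * \<bar>x - y\<bar>"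
    using lipschitzian_onE by blast
  have "(norm (?c - p) + L)-lipschitz_on {0..1} (\<lambda>t. fold_map i j k (?s t))"
  proof (rule lipschitz_onI)
    fix x y :: real assume xy: "x \<in> {0..1}" "y \<in> {0..1}"
    have "fold_map i j k (?s x) - fold_map i j k (?s y) = (x - y) *\<^sub>R (?c - p) + (h x - h y) *\<^sub>R axis k 1"
      by (simp add: fold_map_def h_def algebra_simps)
    then have "norm (fold_map i j k (?s x) - fold_map i j k (?s y)) \<le> \<bar>x - y\<bar> * norm (?c - p) + \<bar>h x - h y\<bar>"
      using norm_triangle_ineq[of "(x - y) *\<^sub>R (?c - p)" "(h x - h y) *\<^sub>R axis k 1"] by simp
    also have "\<dots> \<le> (norm (?c - p) + L) * \<bar>x - y\<bar>" using L(2)[OF xy] by (simp add: algebra_simps)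
    finally show "dist (fold_map i j k (?s x)) (fold_map i j k (?s y)) \<le> (norm (?c - p) + L) * dist x y"
      by (simp add: dist_norm)
  qed (use L in auto)
  then show thesis by (rule that)
qed

lemma rho_finite_of_lipschitz_star:
  fixes Y :: "(real ^ 'n) set"
  assumes op: "open (manifold_interior Y)"
    and star: "\<And>p. p \<in> Y \<Longrightarrow> \<exists>L \<sigma>. L-lipschitz_on {0..1} \<sigma> \<and> \<sigma> 0 = p \<and> \<sigma> 1 = c \<and>
      (\<forall>t. 0 < t \<longrightarrow> t \<le> (1::real) \<longrightarrow> \<sigma> t \<in> manifold_interior Y)"
    and pq: "p \<in> Y" "q \<in> Y"
  shows "rho Y p q < \<infinity>"
proof -
  obtain L \<sigma> where \<sigma>: "L-lipschitz_on {0..1} \<sigma>" "\<sigma> 0 = p" "\<sigma> 1 = c"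
      "\<And>t::real. 0 < t \<Longrightarrow> t \<le> 1 \<Longrightarrow> \<sigma> t \<in> manifold_interior Y"
    using star[OF pq(1)] by blast
  obtain M \<tau> where \<tau>: "M-lipschitz_on {0..1} \<tau>" "\<tau> 0 = q" "\<tau> 1 = c"
      "\<And>t::real. 0 < t \<Longrightarrow> t \<le> 1 \<Longrightarrow> \<tau> t \<in> manifold_interior Y"
    using star[OF pq(2)] by blast
  \<comment> \<open>Each of the two paths is run through at double speed, the second one backwards
    from \<open>c\<close>.\<close>
  define K where "K = 2 * max L M"
  have K: "2 * L \<le> K" "2 * M \<le> K" by (auto simp: K_def)
  define \<gamma> where "\<gamma> = (\<lambda>t::real. if t \<le> 1/2 then \<sigma> (2 * t) else \<tau> (2 - 2 * t))"
  have K0: "0 \<le> K" using K lipschitz_on_nonneg[OF \<sigma>(1)] by linarith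
  have "K-lipschitz_on {0..1} \<gamma>"
    unfolding \<gamma>_def
  proof (rule lipschitz_on_concat)
    show "K-lipschitz_on {0..1/2} (\<lambda>t. \<sigma> (2 * t))"
    proof (rule lipschitz_onI[OF _ K0])
      fix x y :: real assume "x \<in> {0..1/2}" "y \<in> {0..1/2}"
      then have "dist (\<sigma> (2 * x)) (\<sigma> (2 * y)) \<le> L * dist (2 * x) (2 * y)"
        by (intro lipschitz_onD[OF \<sigma>(1)]) auto
      also have "\<dots> = (2 * L) * dist x y" by (auto simp: dist_real_def abs_if)
      also have "\<dots> \<le> K * dist x y" using K by (intro mult_right_mono) auto
      finally show "dist (\<sigma> (2 * x)) (\<sigma> (2 * y)) \<le> K * dist x y" .
    qed
    show "K-lipschitz_on {1/2..1} (\<lambda>t. \<tau> (2 - 2 * t))"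
    proof (rule lipschitz_onI[OF _ K0])
      fix x y :: real assume "x \<in> {1/2..1}" "y \<in> {1/2..1}"
      then have "dist (\<tau> (2 - 2 * x)) (\<tau> (2 - 2 * y)) \<le> M * dist (2 - 2 * x) (2 - 2 * y)"
        by (intro lipschitz_onD[OF \<tau>(1)]) auto
      also have "\<dots> = (2 * M) * dist x y" by (auto simp: dist_real_def abs_if)
      also have "\<dots> \<le> K * dist x y" using K by (intro mult_right_mono) auto
      finally show "dist (\<tau> (2 - 2 * x)) (\<tau> (2 - 2 * y)) \<le> K * dist x y" .
    qed
  qed (simp add: \<sigma> \<tau>)
  moreover have "\<gamma> t \<in> manifold_interior Y" if "0 < t" "t < 1" for t
    using that \<sigma>(4)[of "2 * t"] \<tau>(4)[of "2 - 2 * t"] by (auto simp: \<gamma>_def)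
  ultimately have "rho Y (\<gamma> 0) (\<gamma> 1) \<le> ennreal K" using op by (intro rho_le_lipschitz)
  moreover have "\<gamma> 0 = p" "\<gamma> 1 = q" using \<sigma> \<tau> by (auto simp: \<gamma>_def)
  ultimately show ?thesis by (simp add: le_less_trans)
qed

section \<open>The example and the failure of the triangle inequality\<close>

theorem theorem2:
  assumes "CARD('n::finite) \<ge> 3"
  shows "\<exists>Y :: (real ^ 'n) set.
           C0_manifold_with_boundary Y \<and> compact Y \<and> connected Y \<and> manifold_boundary Y \<noteq> {} \<and>
           (\<forall>x\<in>Y. \<forall>y\<in>Y. rho Y x y < \<infinity>) \<and>
           \<not> metric_on Y (rho Y)"
proof -
  obtain i j k :: 'n where ijk: "i \<noteq> j" "i \<noteq> k" "j \<noteq> k"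
  proof -
    obtain T :: "'n set" where "card T = 3" using obtain_subset_with_card_n[OF assms] by blast
    then show thesis using that by (auto simp: card_3_iff)
  qed
  define Y where "Y = fold_map i j k ` pyramid j"
  let ?I = "manifold_interior Y"
  have manifold: "C0_manifold_with_boundary Y" unfolding Y_def by (rule C0_manifold_fold_map_pyramid[OF ijk(2,3)])
  have compact: "compact Y" unfolding Y_def
    by (rule compact_continuous_image[OF continuous_on_fold_map compact_pyramid])
  have connected: "connected Y" unfolding Y_def
    by (rule connected_continuous_image[OF continuous_on_fold_map convex_connected[OF convex_pyramid]])
  have I: "?I = interior Y" by (rule manifold_interior_eq_interior[OF manifold])
  have open_I: "open ?I" by (simp add: I)
  have sub_I: "fold_map i j k ` open_pyramid j \<subseteq> ?I"
    unfolding I using open_fold_map_open_pyramid[OF ijk(2,3)] open_pyramid_subset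
    by (intro interior_maximal) (auto simp: Y_def)
  have zero_Y: "0 \<in> Y"
  proof -
    have "0 = fold_map i j k 0" by (simp add: fold_map_def fold_height_def)
    moreover have "0 \<in> pyramid j" by (simp add: pyramid_def)
    ultimately show ?thesis unfolding Y_def by (rule image_eqI)
  qed
  have boundary: "manifold_boundary Y \<noteq> {}"
  proof
    assume "manifold_boundary Y = {}"
    then have "interior Y = Y" using I by (simp add: manifold_interior_def)
    then have "open Y" by (metis open_interior)
    then have "Y = {} \<or> Y = UNIV" using compact compact_imp_closed clopen by blast
    then show False using zero_Y compact not_compact_UNIV by blast
  qed
  \<comment> \<open>Strict positivity comes from interiority: a small step in direction
    \<open>- axis j 1\<close> has to stay in \<open>Y\<close>. This excludes the apex.\<close>
  have in_I: "0 < q $ j \<and> q $ j \<le> 1 \<and> \<bar>q $ k - fold_height (q $ i) (q $ j)\<bar> \<le> q $ j" if q: "q \<in> ?I" for q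
  proof -
    have Y_nonneg: "0 \<le> y $ j" if "y \<in> Y" for y
      using that pyramid_nonneg ijk by (auto simp: Y_def fold_map_nth)
    obtain d where d: "d > 0" "cball q d \<subseteq> Y" using q unfolding I mem_interior_cball by blast
    have "q - d *\<^sub>R axis j 1 \<in> cball q d" using d by (simp add: dist_norm)
    then have "0 \<le> (q - d *\<^sub>R axis j 1) $ j" using d Y_nonneg by blast
    then have "0 < q $ j" using d by simp
    moreover have "q \<in> Y" using q by (simp add: manifold_interior_def)
    then obtain p where "p \<in> pyramid j" "q = fold_map i j k p" unfolding Y_def by blast
    ultimately show ?thesis using ijk by (auto simp: fold_map_nth pyramid_def)
  qed
  \<comment> \<open>The strict inequalities describe an open set of pairs, so the bound passes to
    the lower limit at a pair of boundary points.\<close>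
  have far: "4 \<le> smooth_path_dist ?I x y" if x: "x $ i < x $ j / 8" and y: "3 / 4 * y $ j < y $ i" for x y
    unfolding smooth_path_dist_def
  proof (rule INF_greatest, clarify)
    fix \<gamma> assume \<gamma>: "smooth_path \<gamma>" "\<gamma> ` {0..1} \<subseteq> ?I" "x = \<gamma> 0" "y = \<gamma> 1"
    obtain \<l> where \<l>: "\<And>s t. 0 \<le> s \<Longrightarrow> s \<le> t \<Longrightarrow> t \<le> 1 \<Longrightarrow> norm (\<gamma> t - \<gamma> s) \<le> \<l> t - \<l> s"
      and len: "\<l> 1 - \<l> 0 = path_length \<gamma>" and cont: "continuous_on {0..1} \<gamma>"
      using \<gamma>(1) by (rule smooth_path_arc_length) blast
    have lip: "\<bar>\<gamma> t $ m - \<gamma> s $ m\<bar> \<le> \<l> t - \<l> s" if "0 \<le> s" "s \<le> t" "t \<le> 1" for s t m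
      using component_le_norm_cart[of "\<gamma> t - \<gamma> s" m] \<l>[OF that] by simp
    have "4 \<le> \<l> 1 - \<l> 0"
    proof (rule fold_crossing_length[of "\<lambda>t. \<gamma> t $ i" "\<lambda>t. \<gamma> t $ j" "\<lambda>t. \<gamma> t $ k"])
      show "0 < \<gamma> t $ j \<and> \<gamma> t $ j \<le> 1" "\<bar>\<gamma> t $ k - fold_height (\<gamma> t $ i) (\<gamma> t $ j)\<bar> \<le> \<gamma> t $ j"
        if "0 \<le> t" "t \<le> 1" for t
      proof -
        have "\<gamma> t \<in> ?I" using \<gamma>(2) that by (meson atLeastAtMost_iff imageI subsetD)
        from in_I[OF this] show "0 < \<gamma> t $ j \<and> \<gamma> t $ j \<le> 1"
          "\<bar>\<gamma> t $ k - fold_height (\<gamma> t $ i) (\<gamma> t $ j)\<bar> \<le> \<gamma> t $ j" by auto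
      qed
    qed (use cont lip x y \<gamma> in \<open>auto intro!: continuous_intros\<close>)
    then show "4 \<le> ennreal (path_length \<gamma>)" unfolding len using ennreal_leI by fastforce
  qed
  \<comment> \<open>The flat zones are given by homogeneous inequalities between coordinates
    \<open>i\<close> and \<open>j\<close>. So the whole ray through \<open>w\<close> stays in one of
    them, is fixed by the shear, and is a straight path to the apex.\<close>
  have ray: "rho Y 0 w \<le> ennreal (norm w)" "rho Y w 0 \<le> ennreal (norm w)"
    if w: "w $ j = 1" "\<And>m. m \<noteq> j \<Longrightarrow> \<bar>w $ m\<bar> < 1" "w $ i \<le> 1 / 16 \<or> 3 / 4 \<le> w $ i" for w
  proof -
    have int: "t *\<^sub>R w \<in> ?I" if t: "0 < t" "t < 1" for t
    proof -
      have "fold_height ((t *\<^sub>R w) $ i) ((t *\<^sub>R w) $ j) = 0"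
        using t w by (intro fold_height_eq_0) (auto simp: mult_left_mono)
      then have "t *\<^sub>R w = fold_map i j k (t *\<^sub>R w)" by (simp add: fold_map_eq_self)
      moreover have "t *\<^sub>R w \<in> open_pyramid j"
        using t w by (auto simp: open_pyramid_def abs_mult)
      ultimately show ?thesis using sub_I by blast
    qed
    have "(norm w)-lipschitz_on {0..1} (\<lambda>t::real. t *\<^sub>R w)"
      by (rule lipschitz_onI) (auto simp: dist_norm simp flip: scaleR_left_diff_distrib)
    from rho_le_lipschitz[OF this open_I] int show "rho Y 0 w \<le> ennreal (norm w)" by simp
    have "(norm w)-lipschitz_on {0..1} (\<lambda>t::real. (1 - t) *\<^sub>R w)"
      by (rule lipschitz_onI) (auto simp: dist_norm abs_minus_commute simp flip: scaleR_left_diff_distrib)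
    from rho_le_lipschitz[OF this open_I] int show "rho Y w 0 \<le> ennreal (norm w)" by simp
  qed
  have finite: "rho Y p q < \<infinity>" if "p \<in> Y" "q \<in> Y" for p q
  proof (rule rho_finite_of_lipschitz_star[OF open_I _ that, of "fold_map i j k (axis j (1/2))"])
    fix y assume "y \<in> Y"
    then obtain p where p: "p \<in> pyramid j" "y = fold_map i j k p" by (auto simp: Y_def)
    let ?\<sigma> = "\<lambda>t. fold_map i j k ((1 - t) *\<^sub>R p + t *\<^sub>R axis j (1/2))"
    obtain L where "L-lipschitz_on {0..1} ?\<sigma>" using fold_map_segment_lipschitz[OF p(1) ijk(1)] .
    moreover have "?\<sigma> t \<in> ?I" if "0 < t" "t \<le> 1" for t
      using segment_in_open_pyramid[OF p(1) that] sub_I by blast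
    ultimately show "\<exists>L \<sigma>. L-lipschitz_on {0..1} \<sigma> \<and> \<sigma> 0 = y \<and> \<sigma> 1 = fold_map i j k (axis j (1/2)) \<and>
      (\<forall>t. 0 < t \<longrightarrow> t \<le> (1::real) \<longrightarrow> \<sigma> t \<in> ?I)"
      using p(2) by (intro exI[of _ L] exI[of _ ?\<sigma>]) auto
  qed
  define a :: "real ^ 'n" where "a = axis j 1"
  \<comment> \<open>7/8 lies above 3/4, beyond the folds, and below 1, so that the open segment from
    the apex to \<open>b\<close> avoids the side faces.\<close>
  define b :: "real ^ 'n" where "b = axis j 1 + (7/8) *\<^sub>R axis i 1"
  have a: "a $ j = 1" "a $ i = 0" "\<And>m. m \<noteq> j \<Longrightarrow> \<bar>a $ m\<bar> < 1"
    using ijk by (auto simp: a_def axis_def)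
  have b: "b $ j = 1" "b $ i = 7/8" "\<And>m. m \<noteq> j \<Longrightarrow> \<bar>b $ m\<bar> < 1"
    using ijk by (auto simp: b_def axis_def)
  have in_Y: "w \<in> Y" if w: "w $ j = 1" "\<And>m. m \<noteq> j \<Longrightarrow> \<bar>w $ m\<bar> < 1" "w $ i \<le> 1 / 16 \<or> 3 / 4 \<le> w $ i" for w
  proof -
    have "w = fold_map i j k w" using fold_height_eq_0[of "w $ j" "w $ i"] w by (simp add: fold_map_eq_self)
    moreover have "\<bar>w $ m\<bar> \<le> w $ j" for m using w(1) w(2)[of m] by (cases "m = j") auto
    then have "w \<in> pyramid j" using w(1) by (simp add: pyramid_def)
    ultimately show ?thesis unfolding Y_def by (rule image_eqI)
  qed
  have aY: "a \<in> Y" and bY: "b \<in> Y" using in_Y[of a] in_Y[of b] a b by auto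
  have a0: "rho Y a 0 \<le> 1" using ray(2)[of a] a by (simp add: a_def)
  have "norm b \<le> 2" using norm_triangle_ineq[of "axis j 1" "(7/8) *\<^sub>R axis i 1 :: real ^ 'n"]
    by (simp add: b_def)
  then have "ennreal (norm b) \<le> ennreal 2" by (rule ennreal_leI)
  then have b0: "rho Y 0 b \<le> 2" using ray(1)[of b] b by simp
  have ab: "4 \<le> rho Y a b"
    unfolding rho_def
  proof (rule Liminf_bounded)
    let ?S = "{z :: (real ^ 'n) \<times> (real ^ 'n). fst z $ i < fst z $ j / 8} \<inter> {z. 3 / 4 * snd z $ j < snd z $ i}"
    have "open ?S" by (intro open_Int open_Collect_less continuous_intros) auto
    moreover have "(a, b) \<in> ?S" using a b by simp
    ultimately have "eventually (\<lambda>z. z \<in> ?S) (nhds (a, b))" by (rule eventually_nhds_in_open)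
    then show "eventually (\<lambda>z. 4 \<le> (case z of (x', y') \<Rightarrow> smooth_path_dist ?I x' y'))
        (inf (nhds (a, b)) (principal (?I \<times> ?I)))"
      unfolding eventually_inf_principal by eventually_elim (auto intro: far)
  qed
  have "\<not> metric_on Y (rho Y)"
  proof
    assume "metric_on Y (rho Y)"
    then have "Metric_space Y (\<lambda>x y. if x \<in> Y \<and> y \<in> Y then enn2real (rho Y x y) else 0)"
      by (simp add: metric_on_def)
    from Metric_space.triangle[OF this aY zero_Y bY]
    have "enn2real (rho Y a b) \<le> enn2real (rho Y a 0) + enn2real (rho Y 0 b)"
      using aY bY zero_Y by simp
    moreover have "enn2real 4 \<le> enn2real (rho Y a b)"
      using ab finite[OF aY bY] by (intro enn2real_mono) auto
    moreover have "enn2real (rho Y a 0) \<le> enn2real 1" "enn2real (rho Y 0 b) \<le> enn2real 2"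
      using a0 b0 by (intro enn2real_mono; simp)+
    ultimately show False by simp
  qed
  then show ?thesis using manifold compact connected boundary finite by blast
qed

end
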